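(* Let $I=\langle \mathcal P_2,\mathcal Q_2,h_2\rangle$ be the ideal of the polynomial ring $\mathbb C[p_{abcd}: a,b,c,d\in\{1,2\}]$ in 16 variables generated by $\mathcal P_2\cup\mathcal Q_2\cup\{h_2\}$. Then $I$ is prime, and $I$ is the (vanishing) ideal of the Zariski closure of $SOT_{2,2}$ in $\mathbb C^{16}$.
   Context: A symmetric tensor $T\in S^3(\mathbb R^n)$ (an $n\times n\times n$ real tensor whose entries are invariant under permuting the three indices) is called symmetrically odeco if $T=\sum_{i=1}^r\lambda_i v_i^{\otimes 3}$ for some orthonormal vectors $v_1,\ldots,v_r\in\mathbb R^n$ and scalars $\lambda_i\in\mathbb R$. $SOT_{2,n}$ denotes the set of symmetrically odeco tensor trains of length 2, i.e. the set of tensors $P=(p_{abcd})_{a,b,c,d=1}^n\in(\mathbb R^n)^{\otimes 4}\subseteq\mathbb C^{n^4}$ for which there are symmetrically odeco tensors $T,S\in S^3(\mathbb R^n)$ with $p_{abcd}=\sum_{s=1}^n T_{abs}S_{scd}$ for all $a,b,c,d$. Here $n=2$. $\mathcal P_n$ is the set of polynomials $p_{abcd}-p_{\sigma_1(a)\sigma_1(b)\sigma_2(c)\sigma_2(d)}$ with $a,b,c,d\in\{1,\dots,n\}$, $\sigma_1$ a permutation of $\{a,b\}$ and $\sigma_2$ a permutation of $\{c,d\}$. $\mathcal Q_n$ is the set of polynomials $\sum_{t=1}^n (p_{abet}p_{cdft}-p_{abft}p_{cdet})$ and $\sum_{t=1}^n (p_{etab}p_{ftcd}-p_{ftab}p_{etcd})$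 with $a,b,c,d,e,f\in\{1,\dots,n\}$. $h_n= \sum_{k_1,\ldots,k_n=1}^n \sum_{\sigma,\gamma\in S_n}\operatorname{sgn}(\sigma)\operatorname{sgn}(\gamma)\; p_{k_1 \sigma(1) k_n \gamma(1)}\, p_{k_2 \sigma(2) k_1 \gamma(2)}\cdots p_{k_n \sigma(n) k_{n-1} \gamma(n)}$; in particular $h_2=\sum_{k_1,k_2=1}^2\sum_{\sigma,\gamma\in S_2}\operatorname{sgn}(\sigma)\operatorname{sgn}(\gamma)\,p_{k_1\sigma(1)k_2\gamma(1)}\,p_{k_2\sigma(2)k_1\gamma(2)}$, where $S_2$ is the symmetric group on $\{1,2\}$. *)

theory Defs
  imports
    "HOL-Analysis.Analysis"
    "HOL-Library.Poly_Mapping"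
    "HOL-Combinatorics.Permutations"
    "HOL-Algebra.Algebraic_Closure_Type"
begin

section \<open>Complex polynomials and the Zariski topology on affine space\<close>

text \<open>
  Monomials are finitely supported exponent functions \<open>'v \<Rightarrow>\<^sub>0 nat\<close>, and a polynomial is a finitely
  supported assignment of coefficients to monomials; multiplication of \<open>\<Rightarrow>\<^sub>0\<close> is convolution, so
  \<open>'v cpoly\<close> is the polynomial ring over the complex numbers with one variable for each element
  of \<open>'v\<close>.
\<close>

type_synonym 'v cpoly = "('v \<Rightarrow>\<^sub>0 nat) \<Rightarrow>\<^sub>0 complex"

definition Var :: "'v \<Rightarrow> 'v cpoly" where
  "Var i = Poly_Mapping.single (Poly_Mapping.single i 1) 1"

definition eval_cpoly :: "'v::finite cpoly \<Rightarrow> ('v \<Rightarrow> complex) \<Rightarrow> complex" where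
  "eval_cpoly f x =
     (\<Sum>m\<in>Poly_Mapping.keys f. Poly_Mapping.lookup f m * (\<Prod>i\<in>UNIV. x i ^ Poly_Mapping.lookup m i))"

abbreviation cpoly_ring :: "'v cpoly ring" where
  "cpoly_ring \<equiv> ring_of_type_algebra"

definition zero_locus :: "'v::finite cpoly set \<Rightarrow> ('v \<Rightarrow> complex) set" where
  "zero_locus F = {x. \<forall>f\<in>F. eval_cpoly f x = 0}"

definition vanishing_ideal :: "('v::finite \<Rightarrow> complex) set \<Rightarrow> 'v cpoly set" where
  "vanishing_ideal A = {f. \<forall>x\<in>A. eval_cpoly f x = 0}"

definition zariski_closed :: "('v::finite \<Rightarrow> complex) set \<Rightarrow> bool" where
  "zariski_closed Z \<longleftrightarrow> (\<exists>F. Z = zero_locus F)"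

definition zariski_closure :: "('v::finite \<Rightarrow> complex) set \<Rightarrow> ('v \<Rightarrow> complex) set" where
  "zariski_closure A = zariski_closed hull A"

section \<open>Symmetrically odeco tensor trains of length two\<close>

text \<open>A tensor of format \<open>n \<times> n \<times> n\<close> is given by its entries, with \<open>n = CARD('n)\<close>.\<close>

definition symmetric_tensor :: "('n \<Rightarrow> 'n \<Rightarrow> 'n \<Rightarrow> real) \<Rightarrow> bool" where
  "symmetric_tensor T \<longleftrightarrow> (\<forall>a b c. T a b c = T b a c \<and> T a b c = T a c b)"

definition symmetrically_odeco :: "('n::finite \<Rightarrow> 'n \<Rightarrow> 'n \<Rightarrow> real) \<Rightarrow> bool" where
  "symmetrically_odeco T \<longleftrightarrow> symmetric_tensor T \<and>
     (\<exists>(r::nat) (l :: nat \<Rightarrow> real) (v :: nat \<Rightarrow> real ^ 'n).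
        (\<forall>i\<in>{1..r}. \<forall>j\<in>{1..r}. v i \<bullet> v j = (if i = j then 1 else 0)) \<and>
        (\<forall>a b c. T a b c = (\<Sum>i=1..r. l i * (v i $ a * v i $ b * v i $ c))))"

text \<open>Points of complex affine space of dimension \<open>n\<^sup>4\<close> are functions on the index quadruples.\<close>

definition SOT2 :: "('n::finite \<times> 'n \<times> 'n \<times> 'n \<Rightarrow> complex) set" where
  "SOT2 = {P. \<exists>T S. symmetrically_odeco T \<and> symmetrically_odeco S \<and>
     (\<forall>a b c d. P (a, b, c, d) = complex_of_real (\<Sum>s\<in>UNIV. T a b s * S s c d))}"

section \<open>The equations\<close>

abbreviation pvar :: "'n \<Rightarrow> 'n \<Rightarrow> 'n \<Rightarrow> 'n \<Rightarrow> ('n \<times> 'n \<times> 'n \<times> 'n) cpoly" where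
  "pvar a b c d \<equiv> Var (a, b, c, d)"

definition symmetry_eqs :: "('n \<times> 'n \<times> 'n \<times> 'n) cpoly set" where
  "symmetry_eqs = {pvar a b c d - pvar (\<sigma>\<^sub>1 a) (\<sigma>\<^sub>1 b) (\<sigma>\<^sub>2 c) (\<sigma>\<^sub>2 d) | a b c d \<sigma>\<^sub>1 \<sigma>\<^sub>2.
     \<sigma>\<^sub>1 permutes {a, b} \<and> \<sigma>\<^sub>2 permutes {c, d}}"

definition quadratic_eqs :: "('n::finite \<times> 'n \<times> 'n \<times> 'n) cpoly set" where
  "quadratic_eqs =
     {(\<Sum>t\<in>UNIV. pvar a b e t * pvar c d f t - pvar a b f t * pvar c d e t) | a b c d e f. True} \<union>
     {(\<Sum>t\<in>UNIV. pvar e t a b * pvar f t c d - pvar f t a b * pvar e t c d) | a b c d e f. True}"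

text \<open>
  The index set \<open>{1, 2}\<close> is the two-element type \<open>2\<close>, whose elements are \<open>1\<close> and \<open>2\<close> (arithmetic
  is modulo two, so \<open>2 = 0\<close> there).
\<close>

definition h\<^sub>2 :: "(2 \<times> 2 \<times> 2 \<times> 2) cpoly" where
  "h\<^sub>2 = (\<Sum>k\<^sub>1\<in>UNIV. \<Sum>k\<^sub>2\<in>UNIV. \<Sum>\<sigma> | \<sigma> permutes UNIV. \<Sum>\<gamma> | \<gamma> permutes UNIV.
     of_int (sign \<sigma>) * of_int (sign \<gamma>) *
       (pvar k\<^sub>1 (\<sigma> 1) k\<^sub>2 (\<gamma> 1) * pvar k\<^sub>2 (\<sigma> 2) k\<^sub>1 (\<gamma> 2)))"

definition I\<^sub>2 :: "(2 \<times> 2 \<times> 2 \<times> 2) cpoly set" where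
  "I\<^sub>2 = Idl\<^bsub>cpoly_ring\<^esub> (symmetry_eqs \<union> quadratic_eqs \<union> {h\<^sub>2})"

end

theory Submission
  imports Defs
begin

text \<open>
  In suitable coordinates the generators other than \<open>h\<^sub>2\<close> cut out the toric relations
  \<open>u\<^sub>j = \<alpha> y\<^sub>j\<close>, \<open>v\<^sub>i = \<beta> x\<^sub>i\<close>, \<open>m\<^sub>i\<^sub>j = x\<^sub>i y\<^sub>j\<close>, and \<open>h\<^sub>2\<close> becomes \<open>b\<^sup>2 = D(u, v, m)\<close> for one further
  coordinate \<open>b\<close>. Hence every polynomial is congruent to \<open>f + b g\<close> with \<open>f\<close> and \<open>g\<close> polynomials in
  \<open>u, v, m\<close>, and monomials in \<open>u, v, m\<close> with the same toric exponent are congruent.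

  The symmetrically odeco tensors in two dimensions are parametrised by two complex numbers each,
  so tensor trains by \<open>\<complex>\<^sup>4 = \<real>\<^sup>8\<close>. Over an open box of real toric coordinates \<open>D\<close> is positive and both
  values of \<open>b\<close> occur. A polynomial \<open>f + b g\<close> vanishing on tensor trains therefore has \<open>f = g = 0\<close> there,
  so \<open>f\<close> and \<open>g\<close> lie in the ideal. Primality follows since a product of two nonzero polynomial functions
  on \<open>\<real>\<^sup>8\<close> is nonzero, by restriction to a line.
\<close>

section \<open>Complex polynomials\<close>

definition Const :: "complex \<Rightarrow> 'v cpoly" where
  "Const c = Poly_Mapping.single 0 c"

lemma Const_0 [simp]: "Const 0 = 0"
  by (simp add: Const_def)

lemma Const_1 [simp]: "Const 1 = 1"
  by (simp add: Const_def)

lemma Const_add: "Const (c + d) = Const c + Const d"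
  by (simp add: Const_def single_add)

lemma Const_mult: "Const (c * d) = Const c * Const d"
  by (simp add: Const_def mult_single)

lemma update_eq_add_single:
  assumes "m \<notin> Poly_Mapping.keys f"
  shows "Poly_Mapping.update m c f = f + Poly_Mapping.single m c"
proof (rule poly_mapping_eqI)
  fix k
  show "Poly_Mapping.lookup (Poly_Mapping.update m c f) k =
        Poly_Mapping.lookup (f + Poly_Mapping.single m c) k"
    using assms by (auto simp: lookup_update lookup_add lookup_single in_keys_iff when_def)
qed

lemma poly_mapping_single_induct [case_names zero add]:
  assumes "P 0"
    and "\<And>f m c. P f \<Longrightarrow> m \<notin> Poly_Mapping.keys f \<Longrightarrow> P (f + Poly_Mapping.single m c)"
  shows "P f"
proof (induction f rule: update_induct)
  case const
  then show ?case by fact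
next
  case (update f m c)
  then show ?case
    using assms(2)[of f m c] by (simp add: update_eq_add_single)
qed

lemma single_single_eq_power:
  "Poly_Mapping.single (Poly_Mapping.single i k) 1 = (Var i :: 'v cpoly) ^ k"
proof (induction k)
  case 0
  then show ?case by simp
next
  case (Suc k)
  have "Poly_Mapping.single (Poly_Mapping.single i (Suc k)) 1 =
        (Poly_Mapping.single (Poly_Mapping.single i k) 1 * Var i :: 'v cpoly)"
    by (simp add: Var_def mult_single flip: single_add)
  with Suc show ?case by (simp add: mult.commute)
qed

text \<open>Monomials arise by repeated multiplication with variables, so a closure argument needs
  only constants, sums and one variable at a time.\<close>

lemma cpoly_induct [case_names const add mult]:
  fixes f :: "'v cpoly"
  assumes const: "\<And>c. P (Const c)"
    and add: "\<And>f g. P f \<Longrightarrow> P g \<Longrightarrow> P (f + g)"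
    and mult: "\<And>f i. P f \<Longrightarrow> P (f * Var i)"
  shows "P f"
proof -
  have power: "P (f * Var i ^ k)" if "P f" for f i k
    using that by (induction k) (auto simp: mult.assoc[symmetric] power_Suc2 intro: mult simp del: power_Suc)
  have single: "P (Poly_Mapping.single m c)" for m c
  proof (induction m rule: poly_mapping_single_induct)
    case zero
    then show ?case using const by (simp add: Const_def)
  next
    case (add m i k)
    have "Poly_Mapping.single (m + Poly_Mapping.single i k) c =
          (Poly_Mapping.single m c * Var i ^ k :: 'v cpoly)"
      by (simp add: mult_single flip: single_single_eq_power)
    with power[OF add.IH] show ?case by simp
  qed
  show ?thesis
  proof (induction f rule: poly_mapping_single_induct)
    case zero
    then show ?case using const[of 0] by simp
  next
    case (add f m c)
    then show ?case by (intro assms(2) single)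
  qed
qed

lemma eval_single:
  "eval_cpoly (Poly_Mapping.single m c) x = c * (\<Prod>i\<in>UNIV. x i ^ Poly_Mapping.lookup m i)"
  by (cases "c = 0") (auto simp: eval_cpoly_def)

lemma eval_0 [simp]: "eval_cpoly 0 x = 0"
  by (simp add: eval_cpoly_def)

lemma eval_add [simp]: "eval_cpoly (f + g) x = eval_cpoly f x + eval_cpoly g x"
  unfolding eval_cpoly_def
  by (rule setsum_keys_plus_distrib) (auto simp: algebra_simps)

lemma eval_Const [simp]: "eval_cpoly (Const c) x = c"
  by (simp add: Const_def eval_single)

lemma eval_1 [simp]: "eval_cpoly 1 x = 1"
  using eval_Const[of 1 x] by simp

lemma eval_Var [simp]: "eval_cpoly (Var i) x = x i"
proof -
  have "(\<Prod>j\<in>UNIV. x j ^ Poly_Mapping.lookup (Poly_Mapping.single i 1) j) =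
        (\<Prod>j\<in>UNIV. if j = i then x j else 1)"
    by (rule prod.cong) (auto simp: lookup_single when_def)
  then show ?thesis by (simp add: Var_def eval_single)
qed

lemma eval_mult_single:
  "eval_cpoly (f * Poly_Mapping.single n d) x =
     eval_cpoly f x * eval_cpoly (Poly_Mapping.single n d) x"
  by (induction f rule: poly_mapping_single_induct)
    (simp_all add: distrib_right mult_single eval_single lookup_add power_add prod.distrib)

lemma eval_mult [simp]: "eval_cpoly (f * g) x = eval_cpoly f x * eval_cpoly g x"
  by (induction g rule: poly_mapping_single_induct)
    (simp_all add: distrib_left eval_mult_single)

lemma eval_uminus [simp]: "eval_cpoly (- f) x = - eval_cpoly f x"
  using eval_add[of f "- f" x] by (simp add: eq_neg_iff_add_eq_0 add.commute del: eval_add)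

lemma eval_diff [simp]: "eval_cpoly (f - g) x = eval_cpoly f x - eval_cpoly g x"
  using eval_add[of f "- g" x] by (simp del: eval_add)

lemma eval_sum [simp]: "eval_cpoly (\<Sum>a\<in>A. f a) x = (\<Sum>a\<in>A. eval_cpoly (f a) x)"
  by (induction A rule: infinite_finite_induct) auto

lemma eval_numeral [simp]: "eval_cpoly (numeral n) x = numeral n"
  by (induction n) (simp_all only: numeral.simps eval_add eval_1)

text \<open>Serves to restrict a polynomial function to a curve, where infinitely many zeros force
  it to be zero.\<close>

lemma eval_poly_curve:
  fixes f :: "'v::finite cpoly"
  shows "\<exists>q. \<forall>t. poly q t = eval_cpoly f (\<lambda>i. poly (\<gamma> i) t)"
proof (induction f rule: cpoly_induct)
  case (const c)
  show ?case by (rule exI[of _ "[:c:]"]) simp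
next
  case (add f g)
  then obtain p q where "\<forall>t. poly p t = eval_cpoly f (\<lambda>i. poly (\<gamma> i) t)"
    "\<forall>t. poly q t = eval_cpoly g (\<lambda>i. poly (\<gamma> i) t)" by blast
  then show ?case by (intro exI[of _ "p + q"]) simp
next
  case (mult f i)
  then obtain p where "\<forall>t. poly p t = eval_cpoly f (\<lambda>i. poly (\<gamma> i) t)" by blast
  then show ?case by (intro exI[of _ "p * \<gamma> i"]) simp
qed

text \<open>The zero locus of a polynomial that vanishes on \<open>A\<close> is closed and contains
  \<open>A\<close>, hence contains the closure.\<close>

lemma vanishing_ideal_zariski_closure: "vanishing_ideal (zariski_closure A) = vanishing_ideal A"
proof
  have "A \<subseteq> zariski_closure A"
    by (simp add: zariski_closure_def hull_subset)
  then show "vanishing_ideal (zariski_closure A) \<subseteq> vanishing_ideal A"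
    by (auto simp: vanishing_ideal_def)
  show "vanishing_ideal A \<subseteq> vanishing_ideal (zariski_closure A)"
  proof
    fix f assume f: "f \<in> vanishing_ideal A"
    have "zariski_closure A \<subseteq> zero_locus {f}"
      unfolding zariski_closure_def
      using f by (intro hull_minimal) (auto simp: zariski_closed_def vanishing_ideal_def zero_locus_def)
    then show "f \<in> vanishing_ideal (zariski_closure A)"
      by (auto simp: zero_locus_def vanishing_ideal_def)
  qed
qed

section \<open>Congruence modulo the ideal\<close>

lemma ideal_I2: "ideal I\<^sub>2 cpoly_ring"
proof -
  interpret ring "cpoly_ring :: (2 \<times> 2 \<times> 2 \<times> 2) cpoly ring" by (rule ring_from_type_algebra)
  show ?thesis unfolding I\<^sub>2_def
    by (rule genideal_ideal) (simp add: ring_of_type_algebra_def)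
qed

lemma I2_gen: "f \<in> symmetry_eqs \<union> quadratic_eqs \<union> {h\<^sub>2} \<Longrightarrow> f \<in> I\<^sub>2"
proof -
  interpret ring "cpoly_ring :: (2 \<times> 2 \<times> 2 \<times> 2) cpoly ring" by (rule ring_from_type_algebra)
  have "symmetry_eqs \<union> quadratic_eqs \<union> {h\<^sub>2} \<subseteq> I\<^sub>2" unfolding I\<^sub>2_def
    by (rule genideal_self) (simp add: ring_of_type_algebra_def)
  then show "f \<in> symmetry_eqs \<union> quadratic_eqs \<union> {h\<^sub>2} \<Longrightarrow> f \<in> I\<^sub>2" by blast
qed

lemma I2_mult: "f \<in> I\<^sub>2 \<Longrightarrow> g * f \<in> I\<^sub>2"
  using ideal.I_l_closed[OF ideal_I2, of f g] by (simp add: ring_of_type_algebra_def)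

lemma I2_add: "f \<in> I\<^sub>2 \<Longrightarrow> g \<in> I\<^sub>2 \<Longrightarrow> f + g \<in> I\<^sub>2"
  using additive_subgroup.a_closed[OF ideal.axioms(1)[OF ideal_I2], of f g]
  by (simp add: ring_of_type_algebra_def)

lemma I2_0: "0 \<in> I\<^sub>2"
  using additive_subgroup.zero_closed[OF ideal.axioms(1)[OF ideal_I2]]
  by (simp add: ring_of_type_algebra_def)

lemma I2_uminus: "f \<in> I\<^sub>2 \<Longrightarrow> - f \<in> I\<^sub>2"
  using I2_mult[of f "-1"] by simp

lemma I2_diff: "f \<in> I\<^sub>2 \<Longrightarrow> g \<in> I\<^sub>2 \<Longrightarrow> f - g \<in> I\<^sub>2"
  using I2_add[OF _ I2_uminus, of f g] by simp

definition congI :: "(2 \<times> 2 \<times> 2 \<times> 2) cpoly \<Rightarrow> (2 \<times> 2 \<times> 2 \<times> 2) cpoly \<Rightarrow> bool" (infix "\<simeq>\<^sub>I" 50) where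
  "f \<simeq>\<^sub>I g \<longleftrightarrow> f - g \<in> I\<^sub>2"

lemma congI_refl [simp, intro]: "f \<simeq>\<^sub>I f"
  by (simp add: congI_def I2_0)

lemma congI_sym: "f \<simeq>\<^sub>I g \<Longrightarrow> g \<simeq>\<^sub>I f"
  using I2_uminus[of "f - g"] by (simp add: congI_def)

lemma congI_trans [trans]: "f \<simeq>\<^sub>I g \<Longrightarrow> g \<simeq>\<^sub>I h \<Longrightarrow> f \<simeq>\<^sub>I h"
  using I2_add[of "f - g" "g - h"] by (simp add: congI_def)

lemma congI_add: "f \<simeq>\<^sub>I f' \<Longrightarrow> g \<simeq>\<^sub>I g' \<Longrightarrow> f + g \<simeq>\<^sub>I f' + g'"
  using I2_add[of "f - f'" "g - g'"] by (simp add: congI_def algebra_simps)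

lemma congI_diff: "f \<simeq>\<^sub>I f' \<Longrightarrow> g \<simeq>\<^sub>I g' \<Longrightarrow> f - g \<simeq>\<^sub>I f' - g'"
  using I2_diff[of "f - f'" "g - g'"] by (simp add: congI_def algebra_simps)

lemma congI_mult_left: "g \<simeq>\<^sub>I g' \<Longrightarrow> f * g \<simeq>\<^sub>I f * g'"
  using I2_mult[of "g - g'" f] by (simp add: congI_def algebra_simps)

lemma congI_mult: "f \<simeq>\<^sub>I f' \<Longrightarrow> g \<simeq>\<^sub>I g' \<Longrightarrow> f * g \<simeq>\<^sub>I f' * g'"
  using congI_trans[of "f * g" "f * g'" "f' * g'"] congI_mult_left[of g g' f] congI_mult_left[of f f' g']
  by (simp add: mult.commute)

section \<open>The generators as congruences between linear coordinates\<close>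

lemma pvar_swap1: "pvar a b c d \<simeq>\<^sub>I pvar b a c d"
  unfolding congI_def
proof (rule I2_gen, rule UnI1, rule UnI1)
  have "Transposition.transpose a b permutes {a, b}" "id permutes {c, d}"
    by (auto simp: permutes_swap_id permutes_id)
  then show "pvar a b c d - pvar b a c d \<in> symmetry_eqs"
    unfolding symmetry_eqs_def
    by (intro CollectI exI[of _ a] exI[of _ b] exI[of _ c] exI[of _ d]
        exI[of _ "Transposition.transpose a b"] exI[of _ "id"]) (simp)
qed

lemma pvar_swap2: "pvar a b c d \<simeq>\<^sub>I pvar a b d c"
  unfolding congI_def
proof (rule I2_gen, rule UnI1, rule UnI1)
  have "Transposition.transpose c d permutes {c, d}" "id permutes {a, b}"
    by (auto simp: permutes_swap_id permutes_id)
  then show "pvar a b c d - pvar a b d c \<in> symmetry_eqs"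
    unfolding symmetry_eqs_def
    by (intro CollectI exI[of _ a] exI[of _ b] exI[of _ c] exI[of _ d]
        exI[of _ "id"] exI[of _ "Transposition.transpose c d"]) (simp)
qed

lemma sum_perms_2:
  fixes F :: "(2 \<Rightarrow> 2) \<Rightarrow> 'a::comm_monoid_add"
  shows "(\<Sum>\<sigma> | \<sigma> permutes (UNIV :: 2 set). F \<sigma>) = F id + F (Transposition.transpose 1 2)"
proof -
  have f12: "finite {2::2}" "1 \<notin> {2::2}" by auto
  show ?thesis
    unfolding UNIV_2 sum_over_permutations_insert[OF f12] permutes_sing
    by simp
qed

lemma h2_expand:
  "h\<^sub>2 = (\<Sum>k\<^sub>1\<in>UNIV. \<Sum>k\<^sub>2\<in>UNIV.
      pvar k\<^sub>1 1 k\<^sub>2 1 * pvar k\<^sub>2 2 k\<^sub>1 2 - pvar k\<^sub>1 1 k\<^sub>2 2 * pvar k\<^sub>2 2 k\<^sub>1 1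
    - pvar k\<^sub>1 2 k\<^sub>2 1 * pvar k\<^sub>2 1 k\<^sub>1 2 + pvar k\<^sub>1 2 k\<^sub>2 2 * pvar k\<^sub>2 1 k\<^sub>1 1)"
  unfolding h\<^sub>2_def sum_perms_2
  by (simp add: sign_swap_id algebra_simps)

definition trace_form :: "(2 \<times> 2 \<times> 2 \<times> 2) cpoly" where
  "trace_form = pvar 1 1 1 1 + pvar 1 1 2 2 + pvar 2 2 1 1 + pvar 2 2 2 2"

datatype gen = U 2 | V 2 | M 2 2

text \<open>
  Modulo the symmetry equations a point is a \<open>3 \<times> 3\<close> matrix with rows and columns indexed by
  \<open>11\<close>, \<open>12\<close>, \<open>22\<close>. In the new row and column coordinates \<open>11 + 22\<close> (trace), \<open>11 - 22\<close> and
  \<open>2 \<cdot> 12\<close>, numbered 0, 1, 2, its entries are \<open>trace_form\<close> at \<open>(0, 0)\<close>, \<open>U j\<close> at \<open>(0, j)\<close>,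
  \<open>V i\<close> at \<open>(i, 0)\<close> and \<open>M i j\<close> at \<open>(i, j)\<close>.
\<close>

fun form :: "gen \<Rightarrow> (2 \<times> 2 \<times> 2 \<times> 2) cpoly" where
  "form (U j) = (if j = 1 then pvar 1 1 1 1 - pvar 1 1 2 2 + pvar 2 2 1 1 - pvar 2 2 2 2
     else 2 * (pvar 1 1 1 2 + pvar 2 2 1 2))"
| "form (V i) = (if i = 1 then pvar 1 1 1 1 + pvar 1 1 2 2 - pvar 2 2 1 1 - pvar 2 2 2 2
     else 2 * (pvar 1 2 1 1 + pvar 1 2 2 2))"
| "form (M i j) = (if i = 1 then
       (if j = 1 then pvar 1 1 1 1 - pvar 1 1 2 2 - pvar 2 2 1 1 + pvar 2 2 2 2
        else 2 * (pvar 1 1 1 2 - pvar 2 2 1 2))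
     else (if j = 1 then 2 * (pvar 1 2 1 1 - pvar 1 2 2 2) else 4 * pvar 1 2 1 2))"

text \<open>Up to the symmetry of index pairs this is a generator of the second family in
  \<open>quadratic_eqs\<close> with \<open>e = 1\<close> and \<open>f = 2\<close>. It is a 2 x 2
  minor of the matrix with rows 11 - 22 and 12.\<close>

lemma col_minor:
  "(pvar 1 1 a b - pvar 2 2 a b) * pvar 1 2 c d \<simeq>\<^sub>I pvar 1 2 a b * (pvar 1 1 c d - pvar 2 2 c d)"
proof -
  let ?q = "\<Sum>t\<in>UNIV. pvar 1 t a b * pvar 2 t c d - pvar 2 t a b * pvar 1 t c d :: (2 \<times> 2 \<times> 2 \<times> 2) cpoly"
  have q: "?q \<in> I\<^sub>2"
    by (rule I2_gen) (unfold quadratic_eqs_def, blast)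
  have s: "pvar 1 2 x y - pvar 2 1 x y \<in> I\<^sub>2" for x y :: 2
    using pvar_swap1[of 1 2 x y] by (simp add: congI_def)
  have "(pvar 1 1 a b - pvar 2 2 a b) * pvar 1 2 c d - pvar 1 2 a b * (pvar 1 1 c d - pvar 2 2 c d)
    = ?q + (pvar 1 1 a b * (pvar 1 2 c d - pvar 2 1 c d) - pvar 1 1 c d * (pvar 1 2 a b - pvar 2 1 a b))"
    unfolding sum_2 by (simp add: algebra_simps)
  then show ?thesis unfolding congI_def
    by (simp only: I2_add I2_diff I2_mult q s)
qed

text \<open>The transposed minors, from the first family in \<open>quadratic_eqs\<close>.\<close>

lemma row_minor:
  "(pvar a b 1 1 - pvar a b 2 2) * pvar c d 1 2 \<simeq>\<^sub>I pvar a b 1 2 * (pvar c d 1 1 - pvar c d 2 2)"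
proof -
  let ?q = "\<Sum>t\<in>UNIV. pvar a b 1 t * pvar c d 2 t - pvar a b 2 t * pvar c d 1 t :: (2 \<times> 2 \<times> 2 \<times> 2) cpoly"
  have q: "?q \<in> I\<^sub>2"
    by (rule I2_gen) (unfold quadratic_eqs_def, blast)
  have s: "pvar x y 1 2 - pvar x y 2 1 \<in> I\<^sub>2" for x y :: 2
    using pvar_swap2[of x y 1 2] by (simp add: congI_def)
  have "(pvar a b 1 1 - pvar a b 2 2) * pvar c d 1 2 - pvar a b 1 2 * (pvar c d 1 1 - pvar c d 2 2)
    = ?q + (pvar a b 1 1 * (pvar c d 1 2 - pvar c d 2 1) - pvar c d 1 1 * (pvar a b 1 2 - pvar a b 2 1))"
    unfolding sum_2 by (simp add: algebra_simps)
  then show ?thesis unfolding congI_def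
    by (simp only: I2_add I2_diff I2_mult q s)
qed

lemma two_cases: "i = 1 \<or> i = (2::2)"
  using exhaust_2[of i] by blast

text \<open>Rows 1 and 2 of the coordinate matrix are proportional; \<open>V\<close> and
  \<open>M\<close> are their entries in columns 0 and \<open>l\<close>. Up to symmetry only two
  cases are not trivial.\<close>

lemma form_V_M: "form (V i) * form (M k l) \<simeq>\<^sub>I form (V k) * form (M i l)"
proof -
  have 1: "form (V 1) * form (M 2 1) \<simeq>\<^sub>I form (V 2) * form (M 1 1)"
  proof -
    \<comment> \<open>Columns 0 and 1 are the sum and the difference of columns 11 and 22, so their
      minor is -2 times the minor of 11 and 22. The second row carries a further factor 2.\<close>
    have "form (V 1) * form (M 2 1) - form (V 2) * form (M 1 1) =
      (- 4) * ((pvar 1 1 1 1 - pvar 2 2 1 1) * pvar 1 2 2 2 - pvar 1 2 1 1 * (pvar 1 1 2 2 - pvar 2 2 2 2))"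
      by (simp add: algebra_simps)
    with I2_mult[OF col_minor[of 1 1 2 2, unfolded congI_def], of "-4"]
    show ?thesis unfolding congI_def by (simp only:)
  qed
  have 2: "form (V 1) * form (M 2 2) \<simeq>\<^sub>I form (V 2) * form (M 1 2)"
  proof -
    have "form (V 1) * form (M 2 2) - form (V 2) * form (M 1 2) =
      4 * (((pvar 1 1 1 1 - pvar 2 2 1 1) * pvar 1 2 1 2 - pvar 1 2 1 1 * (pvar 1 1 1 2 - pvar 2 2 1 2))
       + ((pvar 1 1 2 2 - pvar 2 2 2 2) * pvar 1 2 1 2 - pvar 1 2 2 2 * (pvar 1 1 1 2 - pvar 2 2 1 2)))"
      by (simp add: algebra_simps)
    with I2_mult[OF I2_add[OF col_minor[of 1 1 1 2, unfolded congI_def] col_minor[of 2 2 1 2, unfolded congI_def]], of 4]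
    show ?thesis unfolding congI_def by (simp only:)
  qed
  from 1 2 congI_sym[OF 1] congI_sym[OF 2] two_cases[of i] two_cases[of k] two_cases[of l]
  show ?thesis by (elim disjE) (simp_all only: congI_refl)
qed

lemma form_U_M: "form (U j) * form (M k l) \<simeq>\<^sub>I form (U l) * form (M k j)"
proof -
  have 1: "form (U 1) * form (M 1 2) \<simeq>\<^sub>I form (U 2) * form (M 1 1)"
  proof -
    have "form (U 1) * form (M 1 2) - form (U 2) * form (M 1 1) =
      (- 4) * ((pvar 1 1 1 1 - pvar 1 1 2 2) * pvar 2 2 1 2 - pvar 1 1 1 2 * (pvar 2 2 1 1 - pvar 2 2 2 2))"
      by (simp add: algebra_simps)
    with I2_mult[OF row_minor[of 1 1 2 2, unfolded congI_def], of "-4"]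
    show ?thesis unfolding congI_def by (simp only:)
  qed
  have 2: "form (U 1) * form (M 2 2) \<simeq>\<^sub>I form (U 2) * form (M 2 1)"
  proof -
    have "form (U 1) * form (M 2 2) - form (U 2) * form (M 2 1) =
      4 * (((pvar 1 1 1 1 - pvar 1 1 2 2) * pvar 1 2 1 2 - pvar 1 1 1 2 * (pvar 1 2 1 1 - pvar 1 2 2 2))
       + ((pvar 2 2 1 1 - pvar 2 2 2 2) * pvar 1 2 1 2 - pvar 2 2 1 2 * (pvar 1 2 1 1 - pvar 1 2 2 2)))"
      by (simp add: algebra_simps)
    with I2_mult[OF I2_add[OF row_minor[of 1 1 1 2, unfolded congI_def] row_minor[of 2 2 1 2, unfolded congI_def]], of 4]
    show ?thesis unfolding congI_def by (simp only:)
  qed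
  from 1 2 congI_sym[OF 1] congI_sym[OF 2] two_cases[of j] two_cases[of k] two_cases[of l]
  show ?thesis by (elim disjE) (simp_all only: congI_refl)
qed

text \<open>\<open>M\<close> has rank one: up to the factor 4 its determinant is a difference of two
  column minors.\<close>

lemma form_M_M: "form (M i l) * form (M k j) \<simeq>\<^sub>I form (M i j) * form (M k l)"
proof -
  have 1: "form (M 1 1) * form (M 2 2) \<simeq>\<^sub>I form (M 1 2) * form (M 2 1)"
  proof -
    have "form (M 1 1) * form (M 2 2) - form (M 1 2) * form (M 2 1) =
      4 * (((pvar 1 1 1 1 - pvar 2 2 1 1) * pvar 1 2 1 2 - pvar 1 2 1 1 * (pvar 1 1 1 2 - pvar 2 2 1 2))
       - ((pvar 1 1 2 2 - pvar 2 2 2 2) * pvar 1 2 1 2 - pvar 1 2 2 2 * (pvar 1 1 1 2 - pvar 2 2 1 2)))"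
      by (simp add: algebra_simps)
    with I2_mult[OF I2_diff[OF col_minor[of 1 1 1 2, unfolded congI_def] col_minor[of 2 2 1 2, unfolded congI_def]], of 4]
    show ?thesis unfolding congI_def by (simp only:)
  qed
  from 1 congI_sym[OF 1] two_cases[of i] two_cases[of j] two_cases[of k] two_cases[of l]
  show ?thesis by (elim disjE) (simp_all only: congI_refl mult.commute)
qed

text \<open>Completes the square: modulo the other generators \<open>h\<^sub>2\<close> is a constant
  multiple of \<open>b_form\<^sup>2 - D_form\<close>, where \<open>D_form\<close> does not involve
  \<open>trace_form\<close>.\<close>

definition b_form :: "(2 \<times> 2 \<times> 2 \<times> 2) cpoly" where
  "b_form = trace_form - form (M 1 1) - form (M 2 2)"

definition D_form :: "(2 \<times> 2 \<times> 2 \<times> 2) cpoly" where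
  "D_form = (form (U 1) - form (V 1))\<^sup>2 + (form (U 2) - form (V 2))\<^sup>2 - (form (M 1 2) - form (M 2 1))\<^sup>2"

lemma congI_sum: "(\<And>a. a \<in> A \<Longrightarrow> f a \<simeq>\<^sub>I g a) \<Longrightarrow> (\<Sum>a\<in>A. f a) \<simeq>\<^sub>I (\<Sum>a\<in>A. g a)"
  by (induction A rule: infinite_finite_induct) (auto intro: congI_add)

text \<open>Unordered index pairs are represented by 11, 12 and 22, which leaves nine variables
  modulo the symmetry equations.\<close>

definition sort_fst :: "2 \<Rightarrow> 2 \<Rightarrow> 2" where "sort_fst a b = (if a = b then a else 1)"
definition sort_snd :: "2 \<Rightarrow> 2 \<Rightarrow> 2" where "sort_snd a b = (if a = b then a else 2)"

lemma pvar_sorted: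
  "pvar a b c d \<simeq>\<^sub>I pvar (sort_fst a b) (sort_snd a b) (sort_fst c d) (sort_snd c d)"
proof -
  have "pvar a b c d \<simeq>\<^sub>I pvar (sort_fst a b) (sort_snd a b) c d" for a b c d
    using two_cases[of a] two_cases[of b] pvar_swap1[of 2 1 c d]
    by (elim disjE) (simp_all only: sort_fst_def sort_snd_def congI_refl, simp_all)
  moreover have "pvar a b c d \<simeq>\<^sub>I pvar a b (sort_fst c d) (sort_snd c d)" for a b c d
    using two_cases[of c] two_cases[of d] pvar_swap2[of a b 2 1]
    by (elim disjE) (simp_all only: sort_fst_def sort_snd_def congI_refl, simp_all)
  ultimately show ?thesis by (rule congI_trans)
qed

lemma b_form_square: "b_form\<^sup>2 \<simeq>\<^sub>I D_form"
proof -
  define q :: "2 \<Rightarrow> 2 \<Rightarrow> 2 \<Rightarrow> 2 \<Rightarrow> (2 \<times> 2 \<times> 2 \<times> 2) cpoly" where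
    "q a b c d = pvar (sort_fst a b) (sort_snd a b) (sort_fst c d) (sort_snd c d)" for a b c d
  \<comment> \<open>This is \<open>h\<^sub>2\<close> with each variable replaced by its sorted
    representative; the identity that follows then holds in the polynomial ring itself.\<close>
  define h where "h = (\<Sum>k\<^sub>1\<in>UNIV. \<Sum>k\<^sub>2\<in>UNIV.
      q k\<^sub>1 1 k\<^sub>2 1 * q k\<^sub>2 2 k\<^sub>1 2 - q k\<^sub>1 1 k\<^sub>2 2 * q k\<^sub>2 2 k\<^sub>1 1
    - q k\<^sub>1 2 k\<^sub>2 1 * q k\<^sub>2 1 k\<^sub>1 2 + q k\<^sub>1 2 k\<^sub>2 2 * q k\<^sub>2 1 k\<^sub>1 1)"
  have "h\<^sub>2 \<simeq>\<^sub>I h"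
    unfolding h2_expand h_def q_def
    by (intro congI_sum congI_add congI_diff congI_mult pvar_sorted)
  moreover have "h\<^sub>2 \<in> I\<^sub>2"
    by (rule I2_gen) simp
  ultimately have h: "h \<in> I\<^sub>2"
    using I2_diff[of "h\<^sub>2" "h\<^sub>2 - h"] by (simp add: congI_def)
  have "b_form\<^sup>2 - D_form =
      4 * (form (M 1 1) * form (M 2 2) - form (M 1 2) * form (M 2 1)) - 8 * h"
    by (simp add: h_def q_def sum_2 sort_fst_def sort_snd_def b_form_def D_form_def trace_form_def
        power2_eq_square algebra_simps)
  moreover have "\<dots> \<in> I\<^sub>2"
    using form_M_M[of 1 1 2 2, unfolded congI_def] by (intro I2_diff[OF I2_mult I2_mult[OF h]])
  ultimately show ?thesis
    by (simp add: congI_def)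
qed

declare form.simps [simp del]

section \<open>Monomials and toric exponents\<close>

text \<open>\<open>Lu\<close> and \<open>Lv\<close> are the parameters \<alpha> and \<beta> of the
  toric relations, \<open>Lx\<close> and \<open>Ly\<close> the parameters x and y.\<close>

datatype letter = Lu | Lv | Lx 2 | Ly 2

fun letters :: "gen \<Rightarrow> letter multiset" where
  "letters (U j) = {#Lu, Ly j#}"
| "letters (V i) = {#Lv, Lx i#}"
| "letters (M i j) = {#Lx i, Ly j#}"

definition mon :: "gen multiset \<Rightarrow> (2 \<times> 2 \<times> 2 \<times> 2) cpoly" where
  "mon w = (\<Prod>g\<in>#w. form g)"

definition toric_exponent :: "gen multiset \<Rightarrow> letter multiset" where
  "toric_exponent w = (\<Sum>g\<in>#w. letters g)"

lemma mon_simps [simp]: "mon {#} = 1" "mon (add_mset g w) = form g * mon w"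
  by (simp_all add: mon_def)

lemma toric_exponent_simps [simp]: "toric_exponent {#} = {#}" "toric_exponent (add_mset g w) = letters g + toric_exponent w"
  by (simp_all add: toric_exponent_def)

lemma mem_toric_exponent: "l \<in># toric_exponent w \<Longrightarrow> \<exists>g\<in>#w. l \<in># letters g"
  by (induction w) auto

lemma X_letters: "Lx i \<in># letters g \<Longrightarrow> g = V i \<or> (\<exists>q. g = M i q)"
  by (cases g) auto

lemma Y_letters: "Ly j \<in># letters g \<Longrightarrow> g = U j \<or> (\<exists>r. g = M r j)"
  by (cases g) auto

lemma split_two:
  assumes "g \<in># w" "g' \<in># w" "g \<noteq> g'"
  obtains w0 where "w = add_mset g (add_mset g' w0)"
  using assms by (metis insert_noteq_member multi_member_split)

lemma swap_pair:
  assumes "form g * form g' \<simeq>\<^sub>I form k * form k'"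
  shows "mon (add_mset g (add_mset g' w)) \<simeq>\<^sub>I mon (add_mset k (add_mset k' w))"
  using congI_mult[OF assms congI_refl[of "mon w"]] by (simp add: mult.assoc)

text \<open>Exchange relations bring the two letters together in one factor. If they sit in
  \<open>V i\<close> and \<open>U j\<close>, the factor \<open>M k l\<close> is needed as an
  intermediary for two exchanges, since no exchange changes the number of \<open>M\<close>
  factors.\<close>

lemma extract_M:
  assumes X: "Lx i \<in># toric_exponent w" and Y: "Ly j \<in># toric_exponent w" and M: "M k l \<in># w"
  obtains w0 where "mon w \<simeq>\<^sub>I mon (add_mset (M i j) w0)" "toric_exponent w = toric_exponent (add_mset (M i j) w0)"
proof (cases "M i j \<in># w")
  case True
  then show ?thesis using that multi_member_split[OF True] congI_refl by metis
next
  case notin: False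
  obtain g1 g2 where g: "g1 \<in># w" "Lx i \<in># letters g1" "g2 \<in># w" "Ly j \<in># letters g2"
    using mem_toric_exponent[OF X] mem_toric_exponent[OF Y] by blast
  from X_letters[OF g(2)] Y_letters[OF g(4)]
  consider (MM) q r where "g1 = M i q" "g2 = M r j" | (MU) q where "g1 = M i q" "g2 = U j"
    | (VM) r where "g1 = V i" "g2 = M r j" | (VU) "g1 = V i" "g2 = U j"
    by blast
  then show ?thesis
  proof cases
    case MM
    with notin g have "g1 \<noteq> g2" by auto
    then obtain w0 where w: "w = add_mset (M i q) (add_mset (M r j) w0)"
      using split_two[OF g(1,3)] MM by metis
    have "mon w \<simeq>\<^sub>I mon (add_mset (M i j) (add_mset (M r q) w0))"
      unfolding w by (rule swap_pair, rule form_M_M)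
    then show ?thesis by (rule that) (simp add: w)
  next
    case MU
    then obtain w0 where w: "w = add_mset (U j) (add_mset (M i q) w0)"
      using split_two[OF g(3,1)] by auto
    have "mon w \<simeq>\<^sub>I mon (add_mset (U q) (add_mset (M i j) w0))"
      unfolding w by (rule swap_pair, rule form_U_M)
    then show ?thesis by (intro that[of "add_mset (U q) w0"]) (simp_all add: w ac_simps add_mset_commute)
  next
    case VM
    then obtain w0 where w: "w = add_mset (V i) (add_mset (M r j) w0)"
      using split_two[OF g(1,3)] by auto
    have "mon w \<simeq>\<^sub>I mon (add_mset (V r) (add_mset (M i j) w0))"
      unfolding w by (rule swap_pair, rule form_V_M)
    then show ?thesis by (intro that[of "add_mset (V r) w0"]) (simp_all add: w ac_simps add_mset_commute)
  next
    case VU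
    then obtain w1 where w1: "w = add_mset (V i) (add_mset (U j) w1)"
      using split_two[OF g(1,3)] by auto
    with M obtain w0 where "w1 = add_mset (M k l) w0"
      using multi_member_split[of "M k l" w1] by auto
    with w1 have w: "w = add_mset (V i) (add_mset (M k l) (add_mset (U j) w0))"
      by (simp add: add_mset_commute)
    have "mon w \<simeq>\<^sub>I mon (add_mset (V k) (add_mset (M i l) (add_mset (U j) w0)))"
      unfolding w by (rule swap_pair, rule form_V_M)
    also have "\<dots> = mon (add_mset (U j) (add_mset (M i l) (add_mset (V k) w0)))"
      by (simp add: ac_simps)
    also have "\<dots> \<simeq>\<^sub>I mon (add_mset (U l) (add_mset (M i j) (add_mset (V k) w0)))"
      by (rule swap_pair, rule form_U_M)
    finally show ?thesis
      by (intro that[of "add_mset (U l) (add_mset (V k) w0)"]) (simp_all add: w ac_simps add_mset_commute)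
  qed
qed

definition is_M :: "gen \<Rightarrow> bool" where
  "is_M g \<longleftrightarrow> (\<exists>i j. g = M i j)"

text \<open>Each \<open>V\<close> contributes one \<open>Lx\<close> and one \<open>Lv\<close>, each
  \<open>M\<close> one \<open>Lx\<close>, and \<open>U\<close> neither. Hence the exponent
  determines the number of \<open>M\<close> factors.\<close>

lemma count_toric_exponent_X_B:
  "count (toric_exponent w) (Lx 1) + count (toric_exponent w) (Lx 2) = count (toric_exponent w) Lv + size (filter_mset is_M w)"
proof (induction w)
  case empty
  then show ?case by simp
next
  case (add g w)
  show ?case
  proof (cases g)
    case (U j)
    with add show ?thesis by (simp add: is_M_def)
  next
    case (V i)
    with add two_cases[of i] show ?thesis by (auto simp: is_M_def)
  next
    case (M i j)
    with add two_cases[of i] show ?thesis by (auto simp: is_M_def)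
  qed
qed

text \<open>Without \<open>M\<close> factors, \<open>Ly j\<close> comes only from \<open>U j\<close>
  and \<open>Lx i\<close> only from \<open>V i\<close>, so the exponent determines the
  monomial.\<close>

lemma count_toric_exponent_no_M:
  assumes "filter_mset is_M w = {#}"
  shows "count w g = (case g of U j \<Rightarrow> count (toric_exponent w) (Ly j) | V i \<Rightarrow> count (toric_exponent w) (Lx i) | M i j \<Rightarrow> 0)"
  using assms
proof (induction w)
  case empty
  then show ?case by (simp split: gen.split)
next
  case (add h w)
  then show ?case
    by (cases h) (auto simp: is_M_def split: gen.splits if_splits)
qed

text \<open>Induction on the number of factors. The exponent fixes the number of \<open>M\<close>
  factors. If there are none, the monomials are equal; otherwise \<open>extract_M\<close> produces
  the same \<open>M i j\<close> on both sides, and it is split off.\<close>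

lemma mon_cong_if_toric_exponent_eq: "toric_exponent w = toric_exponent w' \<Longrightarrow> mon w \<simeq>\<^sub>I mon w'"
proof (induction "size w" arbitrary: w w')
  case 0
  then have "w = {#}" by simp
  moreover have "w' = {#}"
  proof (cases w')
    case (add g v)
    with 0 \<open>w = {#}\<close> show ?thesis by (cases g) auto
  qed simp
  ultimately show ?case by simp
next
  case (Suc n)
  have same: "size (filter_mset is_M w) = size (filter_mset is_M w')"
    using count_toric_exponent_X_B[of w] count_toric_exponent_X_B[of w'] Suc.prems by simp
  show ?case
  proof (cases "filter_mset is_M w = {#}")
    case True
    with same have "filter_mset is_M w' = {#}" by simp
    with True Suc.prems have "w = w'"
      by (intro multiset_eqI) (simp add: count_toric_exponent_no_M split: gen.split)
    then show ?thesis by simp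
  next
    case False
    with same have "filter_mset is_M w' \<noteq> {#}" by (metis size_eq_0_iff_empty)
    then obtain k l where kl: "M k l \<in># w'"
      by (auto simp: is_M_def)
    from False obtain i j where "M i j \<in># w"
      by (auto simp: is_M_def)
    then obtain v where w: "w = add_mset (M i j) v"
      by (metis multi_member_split)
    then have "Lx i \<in># toric_exponent w'" "Ly j \<in># toric_exponent w'"
      using Suc.prems by (metis toric_exponent_simps(2) letters.simps(3) union_iff union_single_eq_member
          add_mset_commute)+
    then obtain v' where v': "mon w' \<simeq>\<^sub>I mon (add_mset (M i j) v')" "toric_exponent w' = toric_exponent (add_mset (M i j) v')"
      using extract_M kl by metis
    have "mon v \<simeq>\<^sub>I mon v'"
      using Suc w v' by (intro Suc.hyps(1)) auto
    then have "mon w \<simeq>\<^sub>I mon (add_mset (M i j) v')"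
      unfolding w mon_simps by (rule congI_mult_left)
    also have "\<dots> \<simeq>\<^sub>I mon w'" by (rule congI_sym, rule v')
    finally show ?thesis .
  qed
qed

section \<open>Reduction to toric normal form\<close>

lemma Const_uminus: "Const (- c) = - Const c"
  using Const_add[of c "- c"] by (simp add: eq_neg_iff_add_eq_0 add.commute)

text \<open>The polynomials in u, v, m, as complex linear combinations of monomials in the forms,
  built term by term to allow induction over the terms.\<close>

inductive_set mon_span :: "(2 \<times> 2 \<times> 2 \<times> 2) cpoly set" where
  zero: "0 \<in> mon_span"
| step: "f \<in> mon_span \<Longrightarrow> Const c * mon w + f \<in> mon_span"

lemma mon_span_add: "f \<in> mon_span \<Longrightarrow> g \<in> mon_span \<Longrightarrow> f + g \<in> mon_span"
  by (induction f rule: mon_span.induct) (auto simp: add.assoc intro: mon_span.step)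

lemma mon_span_Const_mult: "f \<in> mon_span \<Longrightarrow> Const c * f \<in> mon_span"
  by (induction f rule: mon_span.induct)
    (auto simp: distrib_left mult.assoc[symmetric] Const_mult[symmetric] intro: mon_span.intros)

lemma mon_span_form_mult: "f \<in> mon_span \<Longrightarrow> form g * f \<in> mon_span"
proof (induction f rule: mon_span.induct)
  case zero
  then show ?case by (simp add: mon_span.zero)
next
  case (step f c w)
  from mon_span.step[OF step.IH, of c "add_mset g w"] show ?case
    by (simp add: algebra_simps)
qed

lemma mon_span_uminus: "f \<in> mon_span \<Longrightarrow> - f \<in> mon_span"
  using mon_span_Const_mult[of f "-1"] by (simp add: Const_uminus)

lemma mon_span_diff: "f \<in> mon_span \<Longrightarrow> g \<in> mon_span \<Longrightarrow> f - g \<in> mon_span"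
  using mon_span_add[OF _ mon_span_uminus, of f g] by simp

lemma mon_span_1: "1 \<in> mon_span"
  using mon_span.step[OF mon_span.zero, of 1 "{#}"] by simp

lemma mon_span_D_form_mult:
  assumes "f \<in> mon_span"
  shows "D_form * f \<in> mon_span"
proof -
  have *: "(form g - form g')\<^sup>2 * f \<in> mon_span" for g g'
  proof -
    have "(form g - form g')\<^sup>2 * f =
        form g * (form g * f - form g' * f) - form g' * (form g * f - form g' * f)"
      by (simp add: power2_eq_square algebra_simps)
    then show ?thesis
      using assms by (simp add: mon_span_form_mult mon_span_diff)
  qed
  show ?thesis
    unfolding D_form_def left_diff_distrib distrib_right
    by (intro mon_span_diff mon_span_add *)
qed

section \<open>Reduction of every polynomial to the shape \<open>a + b_form * b\<close>\<close>

definition reducible :: "(2 \<times> 2 \<times> 2 \<times> 2) cpoly set" where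
  "reducible = {f. \<exists>a\<in>mon_span. \<exists>b\<in>mon_span. f \<simeq>\<^sub>I a + b_form * b}"

lemma reducibleI:
  "a \<in> mon_span \<Longrightarrow> b \<in> mon_span \<Longrightarrow> f \<simeq>\<^sub>I a + b_form * b \<Longrightarrow> f \<in> reducible"
  unfolding reducible_def by blast

lemma reducible_cong: "f \<simeq>\<^sub>I g \<Longrightarrow> g \<in> reducible \<Longrightarrow> f \<in> reducible"
  unfolding reducible_def by (auto intro: congI_trans)

lemma reducible_add:
  assumes "f \<in> reducible" "g \<in> reducible"
  shows "f + g \<in> reducible"
proof -
  from assms obtain a b a' b' where *: "a \<in> mon_span" "b \<in> mon_span" "a' \<in> mon_span" "b' \<in> mon_span"
    "f \<simeq>\<^sub>I a + b_form * b" "g \<simeq>\<^sub>I a' + b_form * b'"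
    unfolding reducible_def by blast
  from congI_add[OF *(5,6)] have "f + g \<simeq>\<^sub>I (a + a') + b_form * (b + b')"
    by (simp add: algebra_simps)
  then show ?thesis by (rule reducibleI[rotated 2]) (intro mon_span_add *)+
qed

lemma reducible_mult:
  assumes "f \<in> reducible" and h: "\<And>a. a \<in> mon_span \<Longrightarrow> h * a \<in> mon_span"
  shows "h * f \<in> reducible"
proof -
  from assms obtain a b where *: "a \<in> mon_span" "b \<in> mon_span" "f \<simeq>\<^sub>I a + b_form * b"
    unfolding reducible_def by blast
  from congI_mult_left[OF *(3), of h] have "h * f \<simeq>\<^sub>I h * a + b_form * (h * b)"
    by (simp add: algebra_simps)
  then show ?thesis by (rule reducibleI[rotated 2]) (intro h *)+
qed

text \<open>Multiplication by \<open>b_form\<close> exchanges the two components, since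
  \<open>b_form\<^sup>2\<close> may be replaced by \<open>D_form\<close>, a polynomial in the
  forms.\<close>

lemma reducible_b_form_mult:
  assumes "f \<in> reducible"
  shows "b_form * f \<in> reducible"
proof -
  from assms obtain a b where *: "a \<in> mon_span" "b \<in> mon_span" "f \<simeq>\<^sub>I a + b_form * b"
    unfolding reducible_def by blast
  from congI_mult_left[OF *(3), of b_form] have "b_form * f \<simeq>\<^sub>I b_form * a + b * b_form\<^sup>2"
    by (simp add: algebra_simps power2_eq_square)
  also have "\<dots> \<simeq>\<^sub>I b_form * a + b * D_form"
    by (intro congI_add congI_mult b_form_square congI_refl)
  finally have "b_form * f \<simeq>\<^sub>I D_form * b + b_form * a"
    by (simp add: ac_simps)
  then show ?thesis by (rule reducibleI[rotated 2]) (intro mon_span_D_form_mult *)+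
qed

text \<open>These multipliers are closed under sums and products, so reducibility of all polynomials
  follows once the constants and all variables are among them.\<close>

definition reducers :: "(2 \<times> 2 \<times> 2 \<times> 2) cpoly set" where
  "reducers = {h. \<forall>f\<in>reducible. h * f \<in> reducible}"

lemma reducers_Const: "Const c \<in> reducers"
  unfolding reducers_def by (intro CollectI ballI reducible_mult mon_span_Const_mult)

lemma reducers_form: "form g \<in> reducers"
  unfolding reducers_def by (intro CollectI ballI reducible_mult mon_span_form_mult)

lemma reducers_b_form: "b_form \<in> reducers"
  unfolding reducers_def by (intro CollectI ballI reducible_b_form_mult)

lemma reducers_add: "h \<in> reducers \<Longrightarrow> k \<in> reducers \<Longrightarrow> h + k \<in> reducers"
  unfolding reducers_def by (auto simp: distrib_right intro: reducible_add)

lemma reducers_mult: "h \<in> reducers \<Longrightarrow> k \<in> reducers \<Longrightarrow> h * k \<in> reducers"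
  unfolding reducers_def by (auto simp: mult.assoc)

lemma reducers_diff: "h \<in> reducers \<Longrightarrow> k \<in> reducers \<Longrightarrow> h - k \<in> reducers"
  using reducers_add[OF _ reducers_mult[OF reducers_Const[of "-1"]], of h k]
  by (simp add: Const_uminus)

lemma reducers_cong: "h \<simeq>\<^sub>I k \<Longrightarrow> k \<in> reducers \<Longrightarrow> h \<in> reducers"
  unfolding reducers_def by (auto intro: reducible_cong[OF congI_mult[OF _ congI_refl]])

lemma reducers_if_four_mult: "4 * h \<in> reducers \<Longrightarrow> h \<in> reducers"
proof -
  have "Const (1/4 + (1/4 + (1/4 + 1/4))) = (1 :: (2 \<times> 2 \<times> 2 \<times> 2) cpoly)" by simp
  then have "Const (1/4) * 4 = (1 :: (2 \<times> 2 \<times> 2 \<times> 2) cpoly)"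
    unfolding Const_add by (simp add: algebra_simps)
  then have "Const (1/4) * (4 * h) = h" unfolding mult.assoc[symmetric] by simp
  then show "4 * h \<in> reducers \<Longrightarrow> h \<in> reducers"
    using reducers_mult[OF reducers_Const[of "1/4"]] by metis
qed

lemma reducers_pvar: "pvar a b c d \<in> reducers"
proof -
  have plus: "trace_form \<in> reducers"
    using reducers_add[OF reducers_add[OF reducers_b_form reducers_form[of "M 1 1"]] reducers_form[of "M 2 2"]]
    by (simp add: b_form_def)
  \<comment> \<open>The inverse of the change to row and column coordinates, cleared of the
    denominator 4.\<close>
  have "4 * pvar 1 1 1 1 = trace_form + form (U 1) + form (V 1) + form (M 1 1)"
    and "4 * pvar 1 1 2 2 = trace_form - form (U 1) + form (V 1) - form (M 1 1)"
    and "4 * pvar 2 2 1 1 = trace_form + form (U 1) - form (V 1) - form (M 1 1)"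
    and "4 * pvar 2 2 2 2 = trace_form - form (U 1) - form (V 1) + form (M 1 1)"
    and "4 * pvar 1 1 1 2 = form (U 2) + form (M 1 2)"
    and "4 * pvar 2 2 1 2 = form (U 2) - form (M 1 2)"
    and "4 * pvar 1 2 1 1 = form (V 2) + form (M 2 1)"
    and "4 * pvar 1 2 2 2 = form (V 2) - form (M 2 1)"
    and "4 * pvar 1 2 1 2 = form (M 2 2)"
    by (simp_all add: form.simps trace_form_def algebra_simps)
  note eqs = this
  have *: "pvar 1 1 1 1 \<in> reducers" "pvar 1 1 2 2 \<in> reducers" "pvar 2 2 1 1 \<in> reducers"
    "pvar 2 2 2 2 \<in> reducers" "pvar 1 1 1 2 \<in> reducers" "pvar 2 2 1 2 \<in> reducers"
    "pvar 1 2 1 1 \<in> reducers" "pvar 1 2 2 2 \<in> reducers" "pvar 1 2 1 2 \<in> reducers"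
    by (rule reducers_if_four_mult, unfold eqs, intro reducers_add reducers_diff plus reducers_form)+
  have "pvar (sort_fst a b) (sort_snd a b) (sort_fst c d) (sort_snd c d) \<in> reducers"
    using two_cases[of a] two_cases[of b] two_cases[of c] two_cases[of d] *
    by (elim disjE) (simp_all add: sort_fst_def sort_snd_def)
  then show ?thesis
    by (rule reducers_cong[OF pvar_sorted])
qed

lemma reducible_UNIV: "f \<in> reducible"
proof (induction f rule: cpoly_induct)
  case (const c)
  have "1 \<in> reducible"
    unfolding reducible_def
    by (intro CollectI bexI[OF _ mon_span_1] bexI[OF _ mon_span.zero]) simp
  then show ?case
    using reducers_Const[of c] unfolding reducers_def by force
next
  case (add f g)
  then show ?case by (rule reducible_add)
next
  case (mult f i)
  obtain a b c d where "i = (a, b, c, d)" by (cases i)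
  with mult reducers_pvar[of a b c d] show ?case
    unfolding reducers_def by (simp add: mult.commute)
qed

section \<open>Linear independence of monomials with distinct toric exponents\<close>

definition std_mon :: "letter multiset \<Rightarrow> (2 \<times> 2 \<times> 2 \<times> 2) cpoly" where
  "std_mon e = mon (SOME w. toric_exponent w = e)"

lemma mon_cong_std_mon: "mon w \<simeq>\<^sub>I std_mon (toric_exponent w)"
  unfolding std_mon_def by (rule mon_cong_if_toric_exponent_eq, rule sym, rule someI[of _ w]) simp

text \<open>Terms of equal exponent are collected on one representative. \<open>E\<close> stays
  inside the range of \<open>toric_exponent\<close> so that \<open>std_mon e\<close> really has
  exponent \<open>e\<close>.\<close>

lemma mon_span_std_mon:
  assumes "f \<in> mon_span"
  obtains E c where "finite E" "E \<subseteq> range toric_exponent" "f \<simeq>\<^sub>I (\<Sum>e\<in>E. Const (c e) * std_mon e)"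
proof -
  have "\<exists>E c. finite E \<and> E \<subseteq> range toric_exponent \<and> f \<simeq>\<^sub>I (\<Sum>e\<in>E. Const (c e) * std_mon e)"
    using assms
  proof induction
    case zero
    show ?case by (intro exI[of _ "{}"]) simp
  next
    case (step f d w)
    then obtain E c where E: "finite E" "E \<subseteq> range toric_exponent" "f \<simeq>\<^sub>I (\<Sum>e\<in>E. Const (c e) * std_mon e)"
      by blast
    \<comment> \<open>Extending the coefficients by zero covers both cases, the new exponent lying
      in \<open>E\<close> or not.\<close>
    define c0 where "c0 e = (if e \<in> E then c e else 0)" for e
    have *: "(\<Sum>e\<in>E. Const (c e) * std_mon e) = (\<Sum>e\<in>insert (toric_exponent w) E. Const (c0 e) * std_mon e)"
      using E(1) by (intro sum.mono_neutral_cong_left) (auto simp: c0_def)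
    have "Const d * mon w + f \<simeq>\<^sub>I Const d * std_mon (toric_exponent w) + (\<Sum>e\<in>E. Const (c e) * std_mon e)"
      by (intro congI_add congI_mult congI_refl mon_cong_std_mon E(3))
    also have "\<dots> = (\<Sum>e\<in>insert (toric_exponent w) E. Const ((c0(toric_exponent w := d + c0 (toric_exponent w))) e) * std_mon e)"
      unfolding * using E(1)
      by (simp add: sum.insert_remove Const_add algebra_simps)
    finally show ?case
      using E by (intro exI[of _ "insert (toric_exponent w) E"]
          exI[of _ "c0(toric_exponent w := d + c0 (toric_exponent w))"]) auto
  qed
  with that show thesis by blast
qed

text \<open>Induction on the number of variables, with monomials as multisets. For fixed values of
  the others, infinitely many values of the new variable are roots, so each of its powers has
  coefficient zero; these coefficients are polynomials in the remaining variables.\<close>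

lemma mset_polynomial_identity:
  fixes E :: "'l multiset set" and c :: "'l multiset \<Rightarrow> complex"
  assumes "finite S" "finite E" "\<And>e. e \<in> E \<Longrightarrow> set_mset e \<subseteq> S"
    and "\<And>l. l \<in> S \<Longrightarrow> infinite (Z l)"
    and "\<And>z. (\<And>l. l \<in> S \<Longrightarrow> z l \<in> Z l) \<Longrightarrow> (\<Sum>e\<in>E. c e * (\<Prod>l\<in>#e. z l)) = 0"
    and "e \<in> E"
  shows "c e = 0"
  using assms
proof (induction S arbitrary: E c e rule: finite_induct)
  case empty
  then have "E = {{#}}" by auto
  with empty show ?case by auto
next
  case (insert i S)
  define k where "k = count e i"
  define rest where "rest e = filter_mset (\<lambda>l. l \<noteq> i) e" for e :: "'l multiset"
  have split: "e' = rest e' + replicate_mset (count e' i) i" for e'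
    unfolding rest_def by (rule multiset_eqI) auto
  \<comment> \<open>The terms with the same degree \<open>k\<close> in \<open>i\<close> as
    \<open>e\<close>; among them, deleting \<open>i\<close> is injective.\<close>
  define E' where "E' = {e' \<in> E. count e' i = k}"
  have inj: "inj_on rest E'"
  proof (rule inj_onI)
    fix a b assume "a \<in> E'" "b \<in> E'" "rest a = rest b"
    then show "a = b" unfolding E'_def by (metis (mono_tags, lifting) mem_Collect_eq split)
  qed
  define c' where "c' m = c (m + replicate_mset k i)" for m
  have c': "c' (rest e') = c e'" if "e' \<in> E'" for e'
    using that unfolding c'_def E'_def by (metis (mono_tags, lifting) mem_Collect_eq split)
  have "c' (rest e) = 0"
  proof (rule insert.IH[of "rest ` E'"])
    show "finite (rest ` E')" using insert.prems by (simp add: E'_def)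
    show "set_mset m \<subseteq> S" if "m \<in> rest ` E'" for m
      using that insert.prems(2) by (force simp: E'_def rest_def)
    show "infinite (Z l)" if "l \<in> S" for l
      using that insert.prems by simp
    show "rest e \<in> rest ` E'"
      using insert.prems by (simp add: E'_def k_def)
    fix z assume z: "\<And>l. l \<in> S \<Longrightarrow> z l \<in> Z l"
    define p where "p = (\<Sum>e'\<in>E. Polynomial.monom (c e' * (\<Prod>l\<in>#rest e'. z l)) (count e' i))"
    have "poly p t = 0" if t: "t \<in> Z i" for t
    proof -
      define z' where "z' = z(i := t)"
      have prod: "(\<Prod>l\<in>#e'. z' l) = (\<Prod>l\<in>#rest e'. z l) * t ^ count e' i" for e'
      proof -
        have "(\<Prod>l\<in>#rest e'. z' l) = (\<Prod>l\<in>#rest e'. z l)"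
          by (rule arg_cong[where f = prod_mset], rule image_mset_cong) (auto simp: z'_def rest_def)
        moreover have "(\<Prod>l\<in>#e'. z' l) = (\<Prod>l\<in>#rest e'. z' l) * t ^ count e' i"
          using arg_cong[OF split[of e'], of "\<lambda>m. \<Prod>l\<in>#m. z' l"] unfolding image_mset_union prod_mset_Un
          by (simp only: image_replicate_mset prod_mset_replicate_mset) (simp only: z'_def fun_upd_same)
        ultimately show ?thesis by simp
      qed
      have "(\<Sum>e'\<in>E. c e' * (\<Prod>l\<in>#e'. z' l)) = 0"
        using z t by (intro insert.prems(4)) (auto simp: z'_def)
      then show ?thesis
        unfolding prod by (simp add: p_def poly_sum poly_monom mult.assoc)
    qed
    then have "Z i \<subseteq> {t. poly p t = 0}" by blast
    then have "infinite {t. poly p t = 0}"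
      using insert.prems(3)[of i] infinite_super by blast
    then have "p = 0" using poly_roots_finite by blast
    then have "0 = Polynomial.coeff p k" by simp
    also have "\<dots> = (\<Sum>e'\<in>E. if count e' i = k then c e' * (\<Prod>l\<in>#rest e'. z l) else 0)"
      by (simp add: p_def coeff_sum)
    also have "\<dots> = (\<Sum>e'\<in>E'. c e' * (\<Prod>l\<in>#rest e'. z l))"
      using insert.prems by (simp add: E'_def sum.If_cases Int_def)
    also have "\<dots> = (\<Sum>m\<in>rest ` E'. c' m * (\<Prod>l\<in>#m. z l))"
      by (simp add: sum.reindex[OF inj] c')
    finally show "(\<Sum>m\<in>rest ` E'. c' m * (\<Prod>l\<in>#m. z l)) = 0" by simp
  qed
  then show ?case using c' insert.prems by (simp add: E'_def k_def)
qed

lemma UNIV_letter: "UNIV = {Lu, Lv, Lx 1, Lx 2, Ly 1, Ly 2}"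
proof -
  have "l \<in> {Lu, Lv, Lx 1, Lx 2, Ly 1, Ly 2}" for l
  proof (cases l)
    case (Lx i) with two_cases[of i] show ?thesis by auto
  next
    case (Ly i) with two_cases[of i] show ?thesis by auto
  qed auto
  then show ?thesis by blast
qed

lemma eval_mon:
  assumes "\<And>g. eval_cpoly (form g) P = (\<Prod>l\<in>#letters g. z l)"
  shows "eval_cpoly (mon w) P = (\<Prod>l\<in>#toric_exponent w. z l)"
  by (induction w) (simp_all add: assms)

text \<open>Modulo the ideal, \<open>f\<close> is a combination of standard monomials with distinct
  exponents. At \<open>P\<close> these become distinct monomials in \<open>z\<close>, so vanishing
  on the whole product of the sets \<open>Z l\<close> kills every coefficient.\<close>

lemma mon_span_vanishing:
  assumes f: "f \<in> mon_span" and Z: "\<And>l. infinite (Z l)"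
    and P: "\<And>z. (\<And>l. z l \<in> Z l) \<Longrightarrow> \<exists>P. (\<forall>h\<in>I\<^sub>2. eval_cpoly h P = 0) \<and>
      (\<forall>g. eval_cpoly (form g) P = (\<Prod>l\<in>#letters g. z l)) \<and> eval_cpoly f P = 0"
  shows "f \<in> I\<^sub>2"
proof -
  from mon_span_std_mon[OF f] obtain E c
    where E: "finite E" "E \<subseteq> range toric_exponent" "f \<simeq>\<^sub>I (\<Sum>e\<in>E. Const (c e) * std_mon e)" .
  have "(\<Sum>e\<in>E. c e * (\<Prod>l\<in>#e. z l)) = 0" if z: "\<And>l. z l \<in> Z l" for z
  proof -
    from P[OF z] obtain P where P: "\<forall>h\<in>I\<^sub>2. eval_cpoly h P = 0"
      "\<forall>g. eval_cpoly (form g) P = (\<Prod>l\<in>#letters g. z l)" "eval_cpoly f P = 0" by blast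
    have std_mon: "eval_cpoly (std_mon e) P = (\<Prod>l\<in>#e. z l)" if "e \<in> E" for e
    proof -
      \<comment> \<open>The choice in \<open>std_mon e\<close> is meaningful because
        \<open>e\<close> is the exponent of some monomial.\<close>
      from that E(2) have "toric_exponent (SOME w. toric_exponent w = e) = e"
        by (metis (mono_tags) imageE someI subsetD)
      then show ?thesis
        using eval_mon[of P z] P(2) by (metis std_mon_def)
    qed
    have "0 = eval_cpoly f P - eval_cpoly (f - (\<Sum>e\<in>E. Const (c e) * std_mon e)) P"
      using P(1,3) E(3) by (simp add: congI_def del: eval_diff)
    also have "\<dots> = (\<Sum>e\<in>E. c e * (\<Prod>l\<in>#e. z l))"
      by (simp add: std_mon)
    finally show ?thesis by simp
  qed
  note sum_0 = this
  have "c e = 0" if "e \<in> E" for e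
  proof (rule mset_polynomial_identity[where S = UNIV and E = E and Z = Z and c = c and e = e])
    show "finite (UNIV :: letter set)" by (simp add: UNIV_letter)
  qed (use that E(1) Z sum_0 in simp_all)
  then have "f \<simeq>\<^sub>I 0"
    using E(3) by (simp cong: sum.cong)
  then show ?thesis by (simp add: congI_def)
qed

section \<open>Points of tensor trains\<close>

no_notation fps_nth (infixl "$" 75)

lemma ideal_vanishing_ideal: "ideal (vanishing_ideal A) cpoly_ring"
proof (rule idealI)
  let ?R = "cpoly_ring :: 'a cpoly ring"
  show "ring ?R" by (rule ring_from_type_algebra)
  then interpret ring ?R .
  have closed: "\<And>f g. f \<in> vanishing_ideal A \<Longrightarrow> g \<in> vanishing_ideal A \<Longrightarrow> f \<oplus>\<^bsub>?R\<^esub> g \<in> vanishing_ideal A"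
    "\<zero>\<^bsub>?R\<^esub> \<in> vanishing_ideal A"
    by (simp_all add: vanishing_ideal_def ring_of_type_algebra_def)
  have "\<ominus>\<^bsub>?R\<^esub> f \<in> vanishing_ideal A" if "f \<in> vanishing_ideal A" for f
  proof -
    have "f \<oplus>\<^bsub>?R\<^esub> (- f) = \<zero>\<^bsub>?R\<^esub>" "f \<in> carrier ?R" "- f \<in> carrier ?R"
      by (simp_all add: ring_of_type_algebra_def)
    then have "\<ominus>\<^bsub>?R\<^esub> f = - f"
      using minus_equality[of "- f" f] a_comm by metis
    with that show ?thesis by (simp add: vanishing_ideal_def)
  qed
  with closed show "subgroup (vanishing_ideal A) (add_monoid ?R)"
    by (intro subgroup.intro) (auto simp: a_inv_def ring_of_type_algebra_def)
next
  fix f g :: "'a cpoly"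
  assume "f \<in> vanishing_ideal A"
  then show "g \<otimes>\<^bsub>cpoly_ring\<^esub> f \<in> vanishing_ideal A" "f \<otimes>\<^bsub>cpoly_ring\<^esub> g \<in> vanishing_ideal A"
    by (simp_all add: vanishing_ideal_def ring_of_type_algebra_def)
qed

text \<open>Orthonormality collapses the double sum over the frame to the sum of
  \<open>(l i)\<^sup>2\<close> times the fourth tensor power of \<open>v i\<close>, which is
  symmetric in all four indices.\<close>

lemma symmetrically_odeco_contract:
  assumes "symmetrically_odeco T"
  shows "(\<Sum>t\<in>UNIV. T a b t * T c d t) = (\<Sum>t\<in>UNIV. T c b t * T a d t)"
proof -
  from assms obtain r l v where v: "\<And>i j. i \<in> {1..r} \<Longrightarrow> j \<in> {1..r} \<Longrightarrow> v i \<bullet> v j = (if i = j then 1 else 0)"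
    and T: "\<And>a b c. T a b c = (\<Sum>i=1..r::nat. l i * (v i $ a * v i $ b * v i $ c))"
    unfolding symmetrically_odeco_def by blast
  have "(\<Sum>t\<in>UNIV. T a b t * T c d t) = (\<Sum>i=1..r. (l i)\<^sup>2 * (v i $ a * v i $ b * v i $ c * v i $ d))" for a b c d
  proof -
    have "(\<Sum>t\<in>UNIV. T a b t * T c d t) = (\<Sum>t\<in>UNIV. \<Sum>i=1..r. \<Sum>j=1..r.
        l i * (v i $ a * v i $ b) * (l j * (v j $ c * v j $ d)) * (v i $ t * v j $ t))"
      unfolding T sum_product by (simp add: ac_simps)
    also have "\<dots> = (\<Sum>i=1..r. \<Sum>j=1..r. \<Sum>t\<in>UNIV.
        l i * (v i $ a * v i $ b) * (l j * (v j $ c * v j $ d)) * (v i $ t * v j $ t))"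
      by (subst sum.swap, rule sum.cong[OF refl], rule sum.swap)
    also have "\<dots> = (\<Sum>i=1..r. \<Sum>j=1..r.
        l i * (v i $ a * v i $ b) * (l j * (v j $ c * v j $ d)) * (v i \<bullet> v j))"
      by (simp add: inner_vec_def sum_distrib_left)
    also have "\<dots> = (\<Sum>i=1..r. \<Sum>j=1..r.
        if j = i then l i * (v i $ a * v i $ b) * (l j * (v j $ c * v j $ d)) else 0)"
      by (intro sum.cong refl) (simp add: v)
    also have "\<dots> = (\<Sum>i=1..r. (l i)\<^sup>2 * (v i $ a * v i $ b * v i $ c * v i $ d))"
      by (simp add: power2_eq_square ac_simps)
    finally show ?thesis .
  qed
  then show ?thesis by (simp add: ac_simps)
qed

text \<open>Let T1, T2, S1, S2 be the slices of \<open>T\<close> and \<open>S\<close>, which are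
  symmetric matrices. By cyclicity of the trace the value is 2 tr(T1 S1 T2 S2) - 2 tr(T1 S2 T2 S1),
  and transposition shows that both traces agree. The proof expands this in the eight independent
  entries.\<close>

lemma h2_vanishes:
  fixes T S :: "2 \<Rightarrow> 2 \<Rightarrow> 2 \<Rightarrow> real"
  assumes T: "symmetric_tensor T" and S: "symmetric_tensor S"
    and P: "\<And>a b c d. P (a, b, c, d) = complex_of_real (\<Sum>s\<in>UNIV. T a b s * S s c d)"
  shows "eval_cpoly h\<^sub>2 P = 0"
proof -
  have symT: "T 1 2 1 = T 1 1 2" "T 2 1 1 = T 1 1 2" "T 2 1 2 = T 1 2 2" "T 2 2 1 = T 1 2 2"
    and symS: "S 1 2 1 = S 1 1 2" "S 2 1 1 = S 1 1 2" "S 2 1 2 = S 1 2 2" "S 2 2 1 = S 1 2 2"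
    using T S unfolding symmetric_tensor_def by metis+
  define t0 t1 t2 t3 s0 s1 s2 s3 where "t0 = T 1 1 1" "t1 = T 1 1 2" "t2 = T 1 2 2" "t3 = T 2 2 2"
    "s0 = S 1 1 1" "s1 = S 1 1 2" "s2 = S 1 2 2" "s3 = S 2 2 2"
  note defs = this
  let ?R = "\<lambda>a b c d. \<Sum>s\<in>UNIV. T a b s * S s c d"
  have "eval_cpoly h\<^sub>2 P = complex_of_real (\<Sum>k\<^sub>1\<in>UNIV. \<Sum>k\<^sub>2\<in>UNIV.
      ?R k\<^sub>1 1 k\<^sub>2 1 * ?R k\<^sub>2 2 k\<^sub>1 2 - ?R k\<^sub>1 1 k\<^sub>2 2 * ?R k\<^sub>2 2 k\<^sub>1 1
    - ?R k\<^sub>1 2 k\<^sub>2 1 * ?R k\<^sub>2 1 k\<^sub>1 2 + ?R k\<^sub>1 2 k\<^sub>2 2 * ?R k\<^sub>2 1 k\<^sub>1 1)"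
    unfolding h2_expand by (simp add: P)
  also have "(\<Sum>k\<^sub>1\<in>UNIV. \<Sum>k\<^sub>2\<in>UNIV.
      ?R k\<^sub>1 1 k\<^sub>2 1 * ?R k\<^sub>2 2 k\<^sub>1 2 - ?R k\<^sub>1 1 k\<^sub>2 2 * ?R k\<^sub>2 2 k\<^sub>1 1
    - ?R k\<^sub>1 2 k\<^sub>2 1 * ?R k\<^sub>2 1 k\<^sub>1 2 + ?R k\<^sub>1 2 k\<^sub>2 2 * ?R k\<^sub>2 1 k\<^sub>1 1) = 0"
    unfolding sum_2 symT symS defs[symmetric]
    by (simp add: algebra_simps)
  finally show ?thesis by simp
qed

text \<open>Each equation is a combination of differences of contractions of one tensor with itself,
  and these cancel by \<open>symmetrically_odeco_contract\<close>.\<close>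

lemma quadratic_vanishes:
  fixes T S :: "2 \<Rightarrow> 2 \<Rightarrow> 2 \<Rightarrow> real"
  assumes T: "symmetrically_odeco T" and S: "symmetrically_odeco S"
  defines "R \<equiv> \<lambda>a b c d. \<Sum>s\<in>UNIV. T a b s * S s c d"
  shows "(\<Sum>t\<in>UNIV. R a b e t * R c d f t - R a b f t * R c d e t) = 0"
    and "(\<Sum>t\<in>UNIV. R e t a b * R f t c d - R f t a b * R e t c d) = 0"
proof -
  have "(\<Sum>t\<in>UNIV. R a b e t * R c d f t - R a b f t * R c d e t) =
    (\<Sum>s\<in>UNIV. \<Sum>s'\<in>UNIV. T a b s * T c d s' *
       ((\<Sum>t\<in>UNIV. S s e t * S s' f t) - (\<Sum>t\<in>UNIV. S s' e t * S s f t)))"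
    unfolding R_def sum_2 by (simp add: algebra_simps)
  also have "\<dots> = 0"
    using symmetrically_odeco_contract[OF S] by simp
  finally show "(\<Sum>t\<in>UNIV. R a b e t * R c d f t - R a b f t * R c d e t) = 0" .
  \<comment> \<open>Symmetry moves the contracted index of \<open>T\<close> to the last
    place.\<close>
  have sym: "T a b c = T a c b" for a b c
    using T unfolding symmetrically_odeco_def symmetric_tensor_def by metis
  have "(\<Sum>t\<in>UNIV. R e t a b * R f t c d - R f t a b * R e t c d) =
    (\<Sum>s\<in>UNIV. \<Sum>s'\<in>UNIV. S s a b * S s' c d *
       ((\<Sum>t\<in>UNIV. T e t s * T f t s') - (\<Sum>t\<in>UNIV. T f t s * T e t s')))"
    unfolding R_def sum_2 by (simp add: algebra_simps)
  also have "\<dots> = (\<Sum>s\<in>UNIV. \<Sum>s'\<in>UNIV. S s a b * S s' c d *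
       ((\<Sum>t\<in>UNIV. T e s t * T f s' t) - (\<Sum>t\<in>UNIV. T f s t * T e s' t)))"
    by (simp only: sym)
  also have "\<dots> = 0"
    using symmetrically_odeco_contract[OF T] by simp
  finally show "(\<Sum>t\<in>UNIV. R e t a b * R f t c d - R f t a b * R e t c d) = 0" .
qed

lemma I2_subset_vanishing_ideal: "I\<^sub>2 \<subseteq> vanishing_ideal SOT2"
proof -
  interpret ring "cpoly_ring :: (2 \<times> 2 \<times> 2 \<times> 2) cpoly ring" by (rule ring_from_type_algebra)
  have "f \<in> vanishing_ideal SOT2" if f: "f \<in> symmetry_eqs \<union> quadratic_eqs \<union> {h\<^sub>2}" for f
    unfolding vanishing_ideal_def
  proof (intro CollectI ballI)
    fix P :: "2 \<times> 2 \<times> 2 \<times> 2 \<Rightarrow> complex"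
    assume "P \<in> SOT2"
    then obtain T S where T: "symmetrically_odeco T" and S: "symmetrically_odeco S"
      and P: "\<And>a b c d. P (a, b, c, d) = complex_of_real (\<Sum>s\<in>UNIV. T a b s * S s c d)"
      unfolding SOT2_def by blast
    from f consider "f \<in> symmetry_eqs" | "f \<in> quadratic_eqs" | "f = h\<^sub>2" by blast
    then show "eval_cpoly f P = 0"
    proof cases
      case 1
      then obtain a b c d \<sigma> \<tau> where f: "f = pvar a b c d - pvar (\<sigma> a) (\<sigma> b) (\<tau> c) (\<tau> d)"
        and perm: "\<sigma> permutes {a, b}" "\<tau> permutes {c, d}"
        unfolding symmetry_eqs_def by blast
      have swap: "\<sigma> a = a \<and> \<sigma> b = b \<or> \<sigma> a = b \<and> \<sigma> b = a" if "\<sigma> permutes {a, b}" for \<sigma> :: "2 \<Rightarrow> 2" and a b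
        using permutes_in_image[OF that, of a] permutes_in_image[OF that, of b]
          inj_eq[OF permutes_inj[OF that], of a b] by auto
      have "T b a s = T a b s" "S s d c = S s c d" for s
        using T S unfolding symmetrically_odeco_def symmetric_tensor_def by metis+
      then have "P (\<sigma> a, \<sigma> b, \<tau> c, \<tau> d) = P (a, b, c, d)"
        using swap[OF perm(1)] swap[OF perm(2)] unfolding P by (elim disjE conjE) simp_all
      then show ?thesis by (simp add: f)
    next
      case 2
      then obtain a b c d e g where "f = (\<Sum>t\<in>UNIV. pvar a b e t * pvar c d g t - pvar a b g t * pvar c d e t)
        \<or> f = (\<Sum>t\<in>UNIV. pvar e t a b * pvar g t c d - pvar g t a b * pvar e t c d)"
        unfolding quadratic_eqs_def by blast
      then show ?thesis
        using quadratic_vanishes[OF T S, of a b e c d g, THEN arg_cong[where f = complex_of_real]]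
          quadratic_vanishes[OF T S, of e a b g c d, THEN arg_cong[where f = complex_of_real]]
        by (elim disjE) (simp_all add: P)
    next
      case 3
      from T S have "symmetric_tensor T" "symmetric_tensor S"
        unfolding symmetrically_odeco_def by blast+
      from h2_vanishes[OF this P] 3 show ?thesis by simp
    qed
  qed
  then show ?thesis
    unfolding I\<^sub>2_def by (intro genideal_minimal ideal_vanishing_ideal) blast
qed

section \<open>A parametrised family of tensor trains\<close>

text \<open>
  For \<open>x = k e\<^bsup>2i\<theta>\<^esup>\<close> these are the odeco tensors with orthonormal frame at angle \<open>\<theta>\<close>: the slice for
  index \<open>t\<close> is \<open>\<tau>\<^sub>t 1 + \<sigma>\<^sub>t R\<close> up to the factor 2, where \<open>R\<close> is the trace-free symmetric matrix with first
  row \<open>(Re x, Im x)\<close>, \<open>\<sigma> = (Re s, Im s)\<close>, and symmetry of the tensor forces \<open>\<tau>\<close>.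
\<close>

definition odeco_tensor :: "complex \<Rightarrow> complex \<Rightarrow> 2 \<Rightarrow> 2 \<Rightarrow> 2 \<Rightarrow> real" where
  "odeco_tensor x s a b c =
     (if a = 1 \<and> b = 1 \<and> c = 1 then Re s * Re x + Im s * Im x / 2
      else if a = 2 \<and> b = 2 \<and> c = 2 then Re s * Im x / 2 - Im s * Re x
      else if a = 1 \<and> b = 1 \<or> a = 1 \<and> c = 1 \<or> b = 1 \<and> c = 1 then Re s * Im x / 2
      else Im s * Im x / 2)"

lemma symmetrically_odeco_odeco_tensor: "symmetrically_odeco (odeco_tensor x s)"
proof -
  \<comment> \<open>The frame is (p, q), (-q, p), at half the argument of \<open>x\<close>; doubling
    the angle recovers \<open>x\<close>.\<close>
  define k p q where "k = cmod x" "p = cos (Arg x / 2)" "q = sin (Arg x / 2)"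
  note defs = this
  have pq: "p * p + q * q = 1"
    using sin_cos_squared_add3[of "Arg x / 2"] by (simp add: defs)
  have Re: "Re x = k * (p * p - q * q)"
    using arg_cong[OF rcis_cmod_Arg[of x], of Re] cos_double[of "Arg x / 2"]
    by (simp add: defs power2_eq_square)
  have Im: "Im x = 2 * k * p * q"
    using arg_cong[OF rcis_cmod_Arg[of x], of Im] sin_double[of "Arg x / 2"]
    by (simp add: defs ac_simps)
  define v :: "nat \<Rightarrow> real ^ 2" where "v i = (if i = 1 then vector [p, q] else vector [- q, p])" for i
  \<comment> \<open>\<open>k\<close> times the coordinates of \<open>s\<close> in this frame, with
    the sign of the second one reversed.\<close>
  define l where "l i = (if i = 1 then k * (p * Re s + q * Im s) else k * (q * Re s - p * Im s))" for i :: nat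
  have 12: "{1..2::nat} = {1, 2}" by auto
  have sym: "symmetric_tensor (odeco_tensor x s)"
    unfolding symmetric_tensor_def
  proof (intro allI)
    fix a b c :: 2
    show "odeco_tensor x s a b c = odeco_tensor x s b a c \<and> odeco_tensor x s a b c = odeco_tensor x s a c b"
      using two_cases[of a] two_cases[of b] two_cases[of c]
      by (elim disjE) (simp_all add: odeco_tensor_def)
  qed
  have orth: "v i \<bullet> v j = (if i = j then 1 else 0)" if "i \<in> {1..2}" "j \<in> {1..2}" for i j
    using that pq unfolding 12 by (auto simp: v_def inner_vec_def sum_2 vector_2)
  have "odeco_tensor x s a b c = (\<Sum>i=1..2::nat. l i * (v i $ a * v i $ b * v i $ c))" for a b c
  proof -
    have e: "(\<Sum>i=1..2::nat. l i * (v i $ a * v i $ b * v i $ c)) =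
        l 1 * (v 1 $ a * v 1 $ b * v 1 $ c) + l 2 * (v 2 $ a * v 2 $ b * v 2 $ c)" for a b c
      unfolding 12 by simp
    \<comment> \<open>The factor \<open>p * p + q * q\<close>, which equals 1, makes both sides
      homogeneous of degree 4 in p and q, so the identity becomes purely polynomial.\<close>
    have "(Re s * (k * (p * p - q * q)) + Im s * (2 * k * p * q) / 2) * (p * p + q * q) =
        k * (p * Re s + q * Im s) * (p * p * p) + k * (q * Re s - p * Im s) * (- q * - q * - q)"
      by (simp add: field_simps)
    then have id1: "Re s * (k * (p * p - q * q)) + Im s * (2 * k * p * q) / 2 =
        k * (p * Re s + q * Im s) * (p * p * p) + k * (q * Re s - p * Im s) * (- q * - q * - q)"
      unfolding pq by simp
    have "(Re s * (2 * k * p * q) / 2 - Im s * (k * (p * p - q * q))) * (p * p + q * q) =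
        k * (p * Re s + q * Im s) * (q * q * q) + k * (q * Re s - p * Im s) * (p * p * p)"
      by (simp add: field_simps)
    then have id2: "Re s * (2 * k * p * q) / 2 - Im s * (k * (p * p - q * q)) =
        k * (p * Re s + q * Im s) * (q * q * q) + k * (q * Re s - p * Im s) * (p * p * p)"
      unfolding pq by simp
    have "(Re s * (2 * k * p * q) / 2) * (p * p + q * q) =
        k * (p * Re s + q * Im s) * (p * p * q) + k * (q * Re s - p * Im s) * (- q * - q * p)"
      by (simp add: field_simps)
    then have id3: "Re s * (2 * k * p * q) / 2 =
        k * (p * Re s + q * Im s) * (p * p * q) + k * (q * Re s - p * Im s) * (- q * - q * p)"
      unfolding pq by simp
    have "(Im s * (2 * k * p * q) / 2) * (p * p + q * q) =
        k * (p * Re s + q * Im s) * (p * q * q) + k * (q * Re s - p * Im s) * (- q * p * p)"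
      by (simp add: field_simps)
    then have id4: "Im s * (2 * k * p * q) / 2 =
        k * (p * Re s + q * Im s) * (p * q * q) + k * (q * Re s - p * Im s) * (- q * p * p)"
      unfolding pq by simp
    have vals: "v 1 $ 1 = p" "v 1 $ 2 = q" "v 2 $ 1 = - q" "v 2 $ 2 = p"
      "l 1 = k * (p * Re s + q * Im s)" "l 2 = k * (q * Re s - p * Im s)"
      by (simp_all add: v_def l_def vector_2)
    have odeco_tensor: "odeco_tensor x s 1 1 1 = Re s * (k * (p * p - q * q)) + Im s * (2 * k * p * q) / 2"
      "odeco_tensor x s 2 2 2 = Re s * (2 * k * p * q) / 2 - Im s * (k * (p * p - q * q))"
      "odeco_tensor x s 1 1 2 = Re s * (2 * k * p * q) / 2"
      "odeco_tensor x s 1 2 1 = Re s * (2 * k * p * q) / 2"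
      "odeco_tensor x s 2 1 1 = Re s * (2 * k * p * q) / 2"
      "odeco_tensor x s 1 2 2 = Im s * (2 * k * p * q) / 2"
      "odeco_tensor x s 2 1 2 = Im s * (2 * k * p * q) / 2"
      "odeco_tensor x s 2 2 1 = Im s * (2 * k * p * q) / 2"
      unfolding Re[symmetric] Im[symmetric] by (simp_all add: odeco_tensor_def)
    show ?thesis
      using two_cases[of a] two_cases[of b] two_cases[of c] id1 id2 id3 id4 unfolding e
      by (elim disjE) (simp_all only: vals odeco_tensor ac_simps)
  qed
  with sym orth show ?thesis
    unfolding symmetrically_odeco_def by (intro conjI exI[of _ 2] exI[of _ l] exI[of _ v]) blast+
qed

definition train :: "complex \<Rightarrow> complex \<Rightarrow> complex \<Rightarrow> complex \<Rightarrow> 2 \<times> 2 \<times> 2 \<times> 2 \<Rightarrow> complex" where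
  "train x s y r = (\<lambda>(a, b, c, d). complex_of_real (\<Sum>i\<in>UNIV. odeco_tensor x s a b i * odeco_tensor y r i c d))"

lemma train_in_SOT2: "train x s y r \<in> SOT2"
  unfolding SOT2_def train_def using symmetrically_odeco_odeco_tensor by auto

definition coord :: "complex \<Rightarrow> 2 \<Rightarrow> real" where
  "coord x i = (if i = 1 then Re x else Im x)"

lemma odeco_tensor_simps:
  "odeco_tensor x s 1 1 1 = Re s * Re x + Im s * Im x / 2"
  "odeco_tensor x s 2 2 2 = Re s * Im x / 2 - Im s * Re x"
  "odeco_tensor x s 1 1 2 = Re s * Im x / 2" "odeco_tensor x s 1 2 1 = Re s * Im x / 2"
  "odeco_tensor x s 2 1 1 = Re s * Im x / 2"
  "odeco_tensor x s 1 2 2 = Im s * Im x / 2" "odeco_tensor x s 2 1 2 = Im s * Im x / 2"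
  "odeco_tensor x s 2 2 1 = Im s * Im x / 2"
  by (simp_all add: odeco_tensor_def)

text \<open>For \<kappa> = 1 these are the toric relations with parameters \<alpha>, \<beta>, x, y.
  With x and y given, \<open>s * r\<close> fixes \<alpha> and \<beta>, while
  \<open>s * cnj r\<close> fixes \<kappa> and the value of \<open>b_form\<close>.\<close>

lemma eval_form_train:
  fixes x s y r :: complex
  defines "\<alpha> \<equiv> Re x * Re (s * r) + Im x * Im (s * r)"
    and "\<beta> \<equiv> Re y * Re (s * r) + Im y * Im (s * r)"
    and "\<kappa> \<equiv> Re (s * cnj r)"
  shows "eval_cpoly (form (M i j)) (train x s y r) = complex_of_real (\<kappa> * coord x i * coord y j)"
    and "eval_cpoly (form (U j)) (train x s y r) = complex_of_real (\<alpha> * coord y j)"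
    and "eval_cpoly (form (V i)) (train x s y r) = complex_of_real (\<beta> * coord x i)"
    and "eval_cpoly b_form (train x s y r) =
      complex_of_real (- Im (s * cnj r) * (Re x * Im y - Im x * Re y))"
proof -
  define R where "R a b c d = (\<Sum>i\<in>UNIV. odeco_tensor x s a b i * odeco_tensor y r i c d)" for a b c d
  have train: "train x s y r (a, b, c, d) = complex_of_real (R a b c d)" for a b c d
    by (simp add: train_def R_def)
  have M11: "R 1 1 1 1 - R 1 1 2 2 - R 2 2 1 1 + R 2 2 2 2 = \<kappa> * Re x * Re y"
    by (simp add: R_def sum_2 odeco_tensor_simps \<alpha>_def \<beta>_def \<kappa>_def field_simps)
  have M12: "2 * (R 1 1 1 2 - R 2 2 1 2) = \<kappa> * Re x * Im y"
    by (simp add: R_def sum_2 odeco_tensor_simps \<alpha>_def \<beta>_def \<kappa>_def field_simps)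
  have U1: "R 1 1 1 1 - R 1 1 2 2 + R 2 2 1 1 - R 2 2 2 2 = \<alpha> * Re y"
    by (simp add: R_def sum_2 odeco_tensor_simps \<alpha>_def \<beta>_def \<kappa>_def field_simps)
  have V1: "R 1 1 1 1 + R 1 1 2 2 - R 2 2 1 1 - R 2 2 2 2 = \<beta> * Re x"
    by (simp add: R_def sum_2 odeco_tensor_simps \<alpha>_def \<beta>_def \<kappa>_def field_simps)
  have M21: "2 * (R 1 2 1 1 - R 1 2 2 2) = \<kappa> * Im x * Re y"
    by (simp add: R_def sum_2 odeco_tensor_simps \<alpha>_def \<beta>_def \<kappa>_def field_simps)
  have M22: "4 * R 1 2 1 2 = \<kappa> * Im x * Im y"
    by (simp add: R_def sum_2 odeco_tensor_simps \<alpha>_def \<beta>_def \<kappa>_def field_simps)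
  have U2: "2 * (R 1 1 1 2 + R 2 2 1 2) = \<alpha> * Im y"
    by (simp add: R_def sum_2 odeco_tensor_simps \<alpha>_def \<beta>_def \<kappa>_def field_simps)
  have V2: "2 * (R 1 2 1 1 + R 1 2 2 2) = \<beta> * Im x"
    by (simp add: R_def sum_2 odeco_tensor_simps \<alpha>_def \<beta>_def \<kappa>_def field_simps)
  have b: "R 1 1 1 1 + R 1 1 2 2 + R 2 2 1 1 + R 2 2 2 2 - \<kappa> * Re x * Re y - \<kappa> * Im x * Im y =
      - Im (s * cnj r) * (Re x * Im y - Im x * Re y)"
    by (simp add: R_def sum_2 odeco_tensor_simps \<kappa>_def field_simps)
  show M: "eval_cpoly (form (M i j)) (train x s y r) = complex_of_real (\<kappa> * coord x i * coord y j)" for i j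
    using two_cases[of i] two_cases[of j]
      M11[THEN arg_cong[where f = complex_of_real]] M12[THEN arg_cong[where f = complex_of_real]]
      M21[THEN arg_cong[where f = complex_of_real]] M22[THEN arg_cong[where f = complex_of_real]]
    by (elim disjE) (simp_all add: form.simps train coord_def)
  show "eval_cpoly (form (U j)) (train x s y r) = complex_of_real (\<alpha> * coord y j)"
    using two_cases[of j]
      U1[THEN arg_cong[where f = complex_of_real]] U2[THEN arg_cong[where f = complex_of_real]]
    by (elim disjE) (simp_all add: form.simps train coord_def)
  show "eval_cpoly (form (V i)) (train x s y r) = complex_of_real (\<beta> * coord x i)"
    using two_cases[of i]
      V1[THEN arg_cong[where f = complex_of_real]] V2[THEN arg_cong[where f = complex_of_real]]
    by (elim disjE) (simp_all add: form.simps train coord_def)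
  show "eval_cpoly b_form (train x s y r) =
      complex_of_real (- Im (s * cnj r) * (Re x * Im y - Im x * Re y))"
    unfolding b[symmetric] by (simp add: b_form_def trace_form_def M train coord_def)
qed

definition trains :: "(2 \<times> 2 \<times> 2 \<times> 2 \<Rightarrow> complex) set" where
  "trains = {train x s y r | x s y r. True}"

lemma trains_subset_SOT2: "trains \<subseteq> SOT2"
  unfolding trains_def using train_in_SOT2 by blast

lemma eval_mon_span_cong:
  assumes "f \<in> mon_span" and PQ: "\<And>g. eval_cpoly (form g) P = eval_cpoly (form g) Q"
  shows "eval_cpoly f P = eval_cpoly f Q"
proof -
  have mon: "eval_cpoly (mon w) P = eval_cpoly (mon w) Q" for w
    by (induction w) (simp_all add: PQ)
  from assms(1) show ?thesis
    by (induction rule: mon_span.induct) (simp_all add: mon)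
qed

lemma ex_factors:
  fixes \<eta> \<zeta> :: complex
  assumes "cmod \<eta> = cmod \<zeta>" "\<eta> \<noteq> 0"
  obtains s r where "s * r = \<eta>" "s * cnj r = \<zeta>"
proof -
  have "\<zeta> \<noteq> 0" using assms by auto
  \<comment> \<open>If |r| = 1, multiplying the two required equations gives s^2 = \<eta> \<zeta>;
    then r = \<eta> / s.\<close>
  define s where "s = csqrt (\<eta> * \<zeta>)"
  have s2: "s * s = \<eta> * \<zeta>" by (simp add: s_def flip: power2_eq_square)
  have s0: "s \<noteq> 0" using assms \<open>\<zeta> \<noteq> 0\<close> by (simp add: s_def)
  have "s * cnj s * (s * cnj s) = \<eta> * cnj \<eta> * (\<eta> * cnj \<eta>)"
  proof -
    have "s * cnj s * (s * cnj s) = (s * s) * cnj (s * s)" by simp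
    also have "\<dots> = (\<eta> * cnj \<eta>) * (\<zeta> * cnj \<zeta>)" unfolding s2 by simp
    also have "\<zeta> * cnj \<zeta> = \<eta> * cnj \<eta>" using assms by (simp add: complex_norm_square[symmetric])
    finally show ?thesis .
  qed
  then have "(cmod s ^ 2)\<^sup>2 = (cmod \<eta> ^ 2)\<^sup>2"
    unfolding complex_norm_square[symmetric] power2_eq_square[symmetric]
    by (metis of_real_eq_iff of_real_power)
  then have "cmod s ^ 2 = cmod \<eta> ^ 2" by (rule power2_eq_imp_eq) simp_all
  then have "s * cnj s = \<eta> * cnj \<eta>" by (simp add: complex_norm_square[symmetric])
  then have "cnj (\<eta> / s) = s / \<eta>"
    using s0 assms by (simp add: field_simps)
  then have "s * cnj (\<eta> / s) = s * s / \<eta>" by simp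
  then have "s * cnj (\<eta> / s) = \<zeta>"
    unfolding s2 using assms by simp
  moreover have "s * (\<eta> / s) = \<eta>" using s0 by simp
  ultimately show thesis by (rule that[rotated])
qed

text \<open>
  On a box of real toric coordinates the discriminant \<open>D_form\<close> is positive, and the two square
  roots of it, i.e. the two values of \<open>b_form\<close>, are both realised by tensor trains.
\<close>

definition toric_box :: "letter \<Rightarrow> complex set" where
  "toric_box l = complex_of_real ` (case l of Lu \<Rightarrow> {100<..<101} | Lv \<Rightarrow> {0<..<1}
     | Lx i \<Rightarrow> (if i = 1 then {2<..<3} else {0<..<1})
     | Ly j \<Rightarrow> (if j = 1 then {0<..<1} else {2<..<3}))"

lemma infinite_toric_box: "infinite (toric_box l)"
  unfolding toric_box_def
  by (subst finite_image_iff) (auto simp: inj_on_def infinite_Ioo split: letter.split)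

text \<open>The parameters \<alpha>, \<beta>, x, y determine \<eta> = \<open>s * r\<close> by linear
  equations. Then \<open>s * cnj r\<close> must have real part 1, to make \<kappa> = 1, and modulus
  |\<eta>|. This leaves the sign of its imaginary part free, hence the sign of
  \<open>b_form\<close>.\<close>

lemma toric_box_trains:
  assumes z: "\<And>l. z l \<in> toric_box l"
  shows "\<exists>P\<in>trains. \<exists>Q\<in>trains. \<exists>e. e \<noteq> 0 \<and> eval_cpoly b_form P = e \<and> eval_cpoly b_form Q = - e \<and>
    (\<forall>g. eval_cpoly (form g) P = (\<Prod>l\<in>#letters g. z l)) \<and>
    (\<forall>g. eval_cpoly (form g) Q = (\<Prod>l\<in>#letters g. z l))"
proof -
  from z[of Lu] obtain \<alpha> where \<alpha>: "z Lu = of_real \<alpha>" "100 < \<alpha>" by (auto simp: toric_box_def)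
  from z[of Lv] obtain \<beta> where \<beta>: "z Lv = of_real \<beta>" "0 < \<beta>" "\<beta> < 1" by (auto simp: toric_box_def)
  from z[of "Lx 1"] obtain x1 where x1: "z (Lx 1) = of_real x1" "2 < x1" "x1 < 3" by (auto simp: toric_box_def)
  from z[of "Lx 2"] obtain x2 where x2: "z (Lx 2) = of_real x2" "0 < x2" "x2 < 1" by (auto simp: toric_box_def)
  from z[of "Ly 1"] obtain y1 where y1: "z (Ly 1) = of_real y1" "0 < y1" "y1 < 1" by (auto simp: toric_box_def)
  from z[of "Ly 2"] obtain y2 where y2: "z (Ly 2) = of_real y2" "2 < y2" "y2 < 3" by (auto simp: toric_box_def)
  define w where "w = x1 * y2 - x2 * y1"
  have "x2 * y1 < 1 * 1" using x2 y1 by (intro mult_strict_mono) auto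
  moreover have "2 * 2 < x1 * y2" using x1 y2 by (intro mult_strict_mono) auto
  moreover have "x1 * y2 < 3 * 3" using x1 y2 by (intro mult_strict_mono) auto
  moreover have "0 < x2 * y1" using x2 y1 by simp
  ultimately have w: "0 < w" "w < 9" by (simp_all add: w_def)
  \<comment> \<open>Cramer's rule, with determinant \<open>w\<close>.\<close>
  define \<eta>1 \<eta>2 where "\<eta>1 = (\<alpha> * y2 - \<beta> * x2) / w" "\<eta>2 = (\<beta> * x1 - \<alpha> * y1) / w"
  note \<eta> = this
  have \<eta>_w: "\<eta>1 * w = \<alpha> * y2 - \<beta> * x2" "\<eta>2 * w = \<beta> * x1 - \<alpha> * y1"
    using w by (simp_all add: \<eta>)
  have "(x1 * \<eta>1 + x2 * \<eta>2) * w = x1 * (\<eta>1 * w) + x2 * (\<eta>2 * w)"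
    by (simp add: algebra_simps)
  also have "\<dots> = \<alpha> * w" unfolding \<eta>_w by (simp add: w_def algebra_simps)
  finally have \<eta>_x: "x1 * \<eta>1 + x2 * \<eta>2 = \<alpha>" using w by simp
  have "(y1 * \<eta>1 + y2 * \<eta>2) * w = y1 * (\<eta>1 * w) + y2 * (\<eta>2 * w)"
    by (simp add: algebra_simps)
  also have "\<dots> = \<beta> * w" unfolding \<eta>_w by (simp add: w_def algebra_simps)
  finally have \<eta>_y: "y1 * \<eta>1 + y2 * \<eta>2 = \<beta>" using w by simp
  \<comment> \<open>The large range of \<alpha> makes the numerator exceed 199 while
    \<open>w < 9\<close>. The bound \<eta>1 > 1 then ensures that the square root \<delta> is real
    and positive.\<close>
  have "100 * 2 < \<alpha> * y2" using \<alpha> y2 by (intro mult_strict_mono) auto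
  moreover have "\<beta> * x2 < 1 * 1" using \<beta> x2 by (intro mult_strict_mono) auto
  ultimately have "1 < \<eta>1" using w by (simp add: \<eta> less_divide_eq)
  then have "1 < \<eta>1\<^sup>2" by (simp add: one_less_power)
  then have big: "1 < \<eta>1\<^sup>2 + \<eta>2\<^sup>2" by (smt (verit) zero_le_power2)
  define \<delta> where "\<delta> = sqrt (\<eta>1\<^sup>2 + \<eta>2\<^sup>2 - 1)"
  have \<delta>: "\<delta> > 0" "\<delta>\<^sup>2 = \<eta>1\<^sup>2 + \<eta>2\<^sup>2 - 1" using big by (simp_all add: \<delta>_def)
  define x y where "x = Complex x1 x2" "y = Complex y1 y2"
  note xy = this
  have ex: "\<exists>P\<in>trains. (\<forall>g. eval_cpoly (form g) P = (\<Prod>l\<in>#letters g. z l)) \<and>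
      eval_cpoly b_form P = of_real (- d * w)" if d: "d\<^sup>2 = \<delta>\<^sup>2" for d
  proof -
    have "cmod (Complex \<eta>1 \<eta>2) = cmod (Complex 1 d)"
      using d \<delta> by (simp add: cmod_def)
    moreover have "Complex \<eta>1 \<eta>2 \<noteq> 0" using \<open>1 < \<eta>1\<close> by (simp add: complex_eq_iff)
    ultimately obtain s r where sr: "s * r = Complex \<eta>1 \<eta>2" "s * cnj r = Complex 1 d"
      by (rule ex_factors)
    have coord: "of_real (coord x i) = z (Lx i)" "of_real (coord y i) = z (Ly i)" for i
      using two_cases[of i] x1 x2 y1 y2 by (auto simp: coord_def xy)
    have ab: "Re x * Re (s * r) + Im x * Im (s * r) = \<alpha>" "Re y * Re (s * r) + Im y * Im (s * r) = \<beta>"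
      using \<eta>_x \<eta>_y by (simp_all only: sr xy complex.sel)
    have "eval_cpoly (form g) (train x s y r) = (\<Prod>l\<in>#letters g. z l)" for g
    proof (cases g)
      case (U j)
      show ?thesis unfolding U eval_form_train ab by (simp add: coord \<alpha>)
    next
      case (V i)
      show ?thesis unfolding V eval_form_train ab by (simp add: coord \<beta>)
    next
      case (M i j)
      show ?thesis unfolding M eval_form_train sr by (simp add: coord)
    qed
    moreover have "eval_cpoly b_form (train x s y r) = of_real (- d * w)"
      unfolding eval_form_train sr by (simp add: w_def xy)
    ultimately show ?thesis unfolding trains_def by blast
  qed
  obtain P Q where "P \<in> trains" "\<forall>g. eval_cpoly (form g) P = (\<Prod>l\<in>#letters g. z l)"
      "eval_cpoly b_form P = of_real (- \<delta> * w)"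
    and "Q \<in> trains" "\<forall>g. eval_cpoly (form g) Q = (\<Prod>l\<in>#letters g. z l)"
      "eval_cpoly b_form Q = of_real (- (- \<delta>) * w)"
    using ex[OF refl] ex[of "- \<delta>"] by auto
  moreover have "complex_of_real (- \<delta> * w) \<noteq> 0"
    using \<delta>(1) w(1) by simp
  ultimately show ?thesis
    by (intro bexI[of _ P] bexI[of _ Q] exI[of _ "of_real (- \<delta> * w)"]) auto
qed

text \<open>Modulo the ideal \<open>f\<close> is \<open>a + b_form * b\<close>. Two trains with
  equal forms and opposite nonzero values of \<open>b_form\<close> give a + e b = 0 and a - e b = 0,
  so \<open>a\<close> and \<open>b\<close> vanish separately over the box and lie in the
  ideal.\<close>

lemma vanishing_trains_subset_I2: "vanishing_ideal trains \<subseteq> I\<^sub>2"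
proof
  fix f assume f: "f \<in> vanishing_ideal trains"
  obtain a b where a: "a \<in> mon_span" and b: "b \<in> mon_span" and fab: "f \<simeq>\<^sub>I a + b_form * b"
    using reducible_UNIV[of f] unfolding reducible_def by blast
  have I: "eval_cpoly h P = 0" if "P \<in> trains" "h \<in> I\<^sub>2" for h P
    using that I2_subset_vanishing_ideal trains_subset_SOT2 unfolding vanishing_ideal_def by blast
  have ev: "eval_cpoly a P + eval_cpoly b_form P * eval_cpoly b P = 0"
    if P: "P \<in> trains" for P
  proof -
    have "eval_cpoly (f - (a + b_form * b)) P = 0"
      using fab by (intro I P) (simp add: congI_def)
    moreover have "eval_cpoly f P = 0"
      using f P unfolding vanishing_ideal_def by blast
    ultimately show ?thesis
      by (simp only: eval_diff eval_add eval_mult right_minus_eq)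
  qed
  have key: "\<exists>P. (\<forall>h\<in>I\<^sub>2. eval_cpoly h P = 0) \<and>
      (\<forall>g. eval_cpoly (form g) P = (\<Prod>l\<in>#letters g. z l)) \<and> eval_cpoly a P = 0 \<and> eval_cpoly b P = 0"
    if z: "\<And>l. z l \<in> toric_box l" for z
  proof -
    obtain P Q e where PQ: "P \<in> trains" "Q \<in> trains"
      and P: "\<And>g. eval_cpoly (form g) P = (\<Prod>l\<in>#letters g. z l)"
      and Q: "\<And>g. eval_cpoly (form g) Q = (\<Prod>l\<in>#letters g. z l)"
      and e: "eval_cpoly b_form P = e" "eval_cpoly b_form Q = - e" "e \<noteq> 0"
      using toric_box_trains[of z] z by blast
    have eq: "eval_cpoly a Q = eval_cpoly a P" "eval_cpoly b Q = eval_cpoly b P"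
      using a b P Q by (auto intro: eval_mon_span_cong)
    have "eval_cpoly a P + e * eval_cpoly b P = 0" "eval_cpoly a P - e * eval_cpoly b P = 0"
      using ev[OF PQ(1)] ev[OF PQ(2)] by (simp_all add: e eq)
    then have "2 * eval_cpoly a P = 0" "2 * (e * eval_cpoly b P) = 0"
      by (simp_all add: algebra_simps)
    then have "eval_cpoly a P = 0" "eval_cpoly b P = 0" using e by simp_all
    then show ?thesis using I[OF PQ(1)] P by blast
  qed
  have "a \<in> I\<^sub>2" by (rule mon_span_vanishing[where Z = toric_box, OF a infinite_toric_box]) (use key in blast)
  moreover have "b \<in> I\<^sub>2" by (rule mon_span_vanishing[where Z = toric_box, OF b infinite_toric_box]) (use key in blast)
  ultimately have "(f - (a + b_form * b)) + (a + b_form * b) \<in> I\<^sub>2"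
    using fab by (intro I2_add I2_mult) (simp_all add: congI_def)
  then show "f \<in> I\<^sub>2" by simp
qed

text \<open>\<open>I\<^sub>2\<close> lies in the ideal of \<open>SOT2\<close>, this in the ideal of
  \<open>trains\<close>, and that again in \<open>I\<^sub>2\<close>. The parametrised set
  \<open>trains\<close> serves for primality.\<close>

lemma I2_eq_vanishing_trains: "I\<^sub>2 = vanishing_ideal trains"
  and I2_eq_vanishing_SOT2: "I\<^sub>2 = vanishing_ideal SOT2"
proof -
  have "vanishing_ideal SOT2 \<subseteq> vanishing_ideal trains"
    using trains_subset_SOT2 unfolding vanishing_ideal_def by blast
  with I2_subset_vanishing_ideal vanishing_trains_subset_I2
  show "I\<^sub>2 = vanishing_ideal trains" "I\<^sub>2 = vanishing_ideal SOT2"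
    by blast+
qed

section \<open>Primality\<close>

text \<open>The polynomial is complex although \<open>h\<close> is real, to match the complex
  polynomials in \<open>eval_poly_curve\<close>.\<close>

definition poly_curve :: "(real \<Rightarrow> real) \<Rightarrow> bool" where
  "poly_curve h \<longleftrightarrow> (\<exists>p. \<forall>t. complex_of_real (h t) = poly p (of_real t))"

lemma poly_curve_const: "poly_curve (\<lambda>t. c)"
  unfolding poly_curve_def by (rule exI[of _ "[:of_real c:]"]) simp

lemma poly_curve_add: "poly_curve g \<Longrightarrow> poly_curve h \<Longrightarrow> poly_curve (\<lambda>t. g t + h t)"
  unfolding poly_curve_def by (metis of_real_add poly_add)

lemma poly_curve_diff: "poly_curve g \<Longrightarrow> poly_curve h \<Longrightarrow> poly_curve (\<lambda>t. g t - h t)"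
  unfolding poly_curve_def by (metis of_real_diff poly_diff)

lemma poly_curve_mult: "poly_curve g \<Longrightarrow> poly_curve h \<Longrightarrow> poly_curve (\<lambda>t. g t * h t)"
  unfolding poly_curve_def by (metis of_real_mult poly_mult)

lemma poly_curve_half: "poly_curve h \<Longrightarrow> poly_curve (\<lambda>t. h t / 2)"
  using poly_curve_mult[OF poly_curve_const[of "1/2"]] by simp

lemma poly_curve_id: "poly_curve (\<lambda>t. t)"
  unfolding poly_curve_def by (rule exI[of _ "[:0, 1:]"]) simp

lemma poly_curve_odeco_tensor:
  assumes "poly_curve (\<lambda>t. Re (x t))" "poly_curve (\<lambda>t. Im (x t))"
    "poly_curve (\<lambda>t. Re (s t))" "poly_curve (\<lambda>t. Im (s t))"
  shows "poly_curve (\<lambda>t. odeco_tensor (x t) (s t) a b c)"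
  using two_cases[of a] two_cases[of b] two_cases[of c]
  by (elim disjE; simp only: odeco_tensor_simps;
      intro poly_curve_add poly_curve_diff poly_curve_half poly_curve_mult assms)

definition segment_at :: "complex \<Rightarrow> complex \<Rightarrow> real \<Rightarrow> complex" where
  "segment_at x x' t = x + of_real t * (x' - x)"

text \<open>Parameters at which \<open>f\<close> and \<open>g\<close>, respectively, do not vanish
  are joined by a line. Along it both become univariate polynomials whose product has every real
  number as a root, so one of them is zero, contradicting its value at t = 0 or t = 1.\<close>

lemma vanishing_trains_prime:
  assumes fg: "f * g \<in> vanishing_ideal trains"
  shows "f \<in> vanishing_ideal trains \<or>
    g \<in> vanishing_ideal trains"
proof (rule ccontr)
  assume "\<not> ?thesis"
  then obtain x s y r x' s' y' r' where f: "eval_cpoly f (train x s y r) \<noteq> 0"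
    and g: "eval_cpoly g (train x' s' y' r') \<noteq> 0"
    unfolding vanishing_ideal_def trains_def by blast
  define c where "c t = train (segment_at x x' t) (segment_at s s' t) (segment_at y y' t) (segment_at r r' t)" for t
  have "\<exists>p. \<forall>t. c t i = poly p (of_real t)" for i
  proof -
    obtain a b k d where i: "i = (a, b, k, d)" by (cases i)
    have seg: "poly_curve (\<lambda>t. Re (segment_at u v t))" "poly_curve (\<lambda>t. Im (segment_at u v t))" for u v
      unfolding segment_at_def
      by (simp_all, (intro poly_curve_add poly_curve_mult poly_curve_const poly_curve_id)+)
    have "poly_curve (\<lambda>t. \<Sum>j\<in>UNIV. odeco_tensor (segment_at x x' t) (segment_at s s' t) a b j *
        odeco_tensor (segment_at y y' t) (segment_at r r' t) j k d)"
      unfolding sum_2 by (intro poly_curve_add poly_curve_mult poly_curve_odeco_tensor seg)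
    then show ?thesis unfolding poly_curve_def c_def train_def i by simp
  qed
  then obtain \<gamma> where \<gamma>: "\<And>i t. c t i = poly (\<gamma> i) (of_real t)" by metis
  have c: "(\<lambda>i. poly (\<gamma> i) (of_real t)) = c t" for t by (rule ext) (simp add: \<gamma>)
  obtain p q where "\<And>t. poly p t = eval_cpoly f (\<lambda>i. poly (\<gamma> i) t)" "\<And>t. poly q t = eval_cpoly g (\<lambda>i. poly (\<gamma> i) t)"
    using eval_poly_curve by metis
  then have p: "poly p (of_real t) = eval_cpoly f (c t)" and q: "poly q (of_real t) = eval_cpoly g (c t)" for t
    by (simp_all add: c)
  have "poly (p * q) (of_real t) = 0" for t
  proof -
    have "c t \<in> trains" unfolding c_def trains_def by blast
    with fg have "eval_cpoly (f * g) (c t) = 0" unfolding vanishing_ideal_def by blast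
    then show ?thesis by (simp add: p q)
  qed
  then have "range complex_of_real \<subseteq> {t. poly (p * q) t = 0}" by blast
  moreover have "infinite (range complex_of_real)"
    by (simp add: finite_image_iff inj_of_real infinite_UNIV_char_0)
  ultimately have "p * q = 0"
    using poly_roots_finite infinite_super by blast
  moreover have "poly p (of_real 0) \<noteq> 0" using f by (simp only: p c_def segment_at_def) simp
  moreover have "poly q (of_real 1) \<noteq> 0" using g by (simp only: q c_def segment_at_def) simp
  ultimately show False by auto
qed

theorem mainTheorem3:
  shows "primeideal I\<^sub>2 cpoly_ring \<and> I\<^sub>2 = vanishing_ideal (zariski_closure SOT2)"
proof
  have cring: "cring (cpoly_ring :: (2 \<times> 2 \<times> 2 \<times> 2) cpoly ring)" by (rule cring_from_type_algebra)
  show "primeideal I\<^sub>2 cpoly_ring"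
  proof (rule primeidealI[OF ideal_I2 cring])
    \<comment> \<open>Some point is needed at which the constant 1 does not vanish, so that the
      ideal is proper.\<close>
    have "train 0 0 0 0 \<in> trains" unfolding trains_def by blast
    then have "1 \<notin> I\<^sub>2"
      unfolding I2_eq_vanishing_trains vanishing_ideal_def by auto
    then show "carrier cpoly_ring \<noteq> I\<^sub>2"
      by (auto simp: ring_of_type_algebra_def)
    fix f g :: "(2 \<times> 2 \<times> 2 \<times> 2) cpoly"
    assume "f \<otimes>\<^bsub>cpoly_ring\<^esub> g \<in> I\<^sub>2"
    then show "f \<in> I\<^sub>2 \<or> g \<in> I\<^sub>2"
      using vanishing_trains_prime[of f g]
      unfolding I2_eq_vanishing_trains by (simp add: ring_of_type_algebra_def)
  qed
  show "I\<^sub>2 = vanishing_ideal (zariski_closure SOT2)"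
    using I2_eq_vanishing_SOT2 by (simp add: vanishing_ideal_zariski_closure)
qed

end
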